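(* Let $\omega$ be a primitive cubic root of unity and $|q|<1$. Then $$\sum_{n=0}^\infty \frac{(-\omega;q)_n(-\omega^2;q^2)_n}{(\omega^2q;q^2)_n (q^3;q^3)_n}\omega^nq^{n(n+3)/2}=\frac{J_{5,12}}{J_3(\omega q^2;q^4)_\infty},$$ $$\sum_{n=0}^{\infty}\frac{(\omega q^4;q^4)_n}{(q^3;q^3)_n(\omega q;q)_{n+1}(\omega^2q;q^2)_{n+1}}\omega^nq^{n(n+3)/2}=\frac{J_{1,12}}{J_3(\omega q^2;q^4)_\infty}.$$
   Context: Here $q$ is a complex number with $|q|<1$. For a base $p$ with $|p|<1$: $(a;p)_\infty=\prod_{k\ge 0}(1-ap^k)$, $(a;p)_n=\prod_{k=0}^{n-1}(1-ap^k)$ for integers $n\ge 0$, and $(a_1,\dots,a_m;p)_\infty=(a_1;p)_\infty\cdots(a_m;p)_\infty$. Notation: $J_m:=(q^m;q^m)_\infty$ and $J_{a,m}:=(q^a,q^{m-a},q^m;q^m)_\infty$. *)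

theory Defs
  imports "HOL-Analysis.Analysis"
begin

definition primitive_root_of_unity :: "nat \<Rightarrow> complex \<Rightarrow> bool" where
  "primitive_root_of_unity n w \<longleftrightarrow> n > 0 \<and> w ^ n = 1 \<and> (\<forall>k. 0 < k \<and> k < n \<longrightarrow> w ^ k \<noteq> 1)"

(* The finite q-shifted factorial (a;p)_n. *)
definition qpoch :: "complex \<Rightarrow> complex \<Rightarrow> nat \<Rightarrow> complex" where
  "qpoch a p n = (\<Prod>k<n. 1 - a * p ^ k)"

(* The infinite q-shifted factorial (a;p)_\<infinity>, meaningful for norm p < 1, where the product
   converges; prodinf also covers the case of a vanishing factor, with value 0. *)
definition qpoch_inf :: "complex \<Rightarrow> complex \<Rightarrow> complex" where
  "qpoch_inf a p = (\<Prod>k. 1 - a * p ^ k)"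

(* J_m, with the nome q as an explicit last argument; only used for m > 0. *)
definition J1 :: "nat \<Rightarrow> complex \<Rightarrow> complex" where
  "J1 m q = qpoch_inf (q ^ m) (q ^ m)"

(* J_{a,m}; the exponent m - a is natural subtraction, so this is only used for a \<le> m. *)
definition J2 :: "nat \<Rightarrow> nat \<Rightarrow> complex \<Rightarrow> complex" where
  "J2 a m q = qpoch_inf (q ^ a) (q ^ m) * qpoch_inf (q ^ (m - a)) (q ^ m) * qpoch_inf (q ^ m) (q ^ m)"

end

theory Submission
  imports Defs
begin

text \<open>
  Write $t_n = (-\omega;q)_n(-\omega^2;q^2)_n / ((\omega^2q;q^2)_n(q^3;q^3)_n)$ and
  $T_k = \sum_n t_n \omega^n q^{n(n+1)/2+kn}$. The first series is $T_1$, and an index shift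
  (whose boundary term carries the factor $1+\omega+\omega^2=0$) shows that $q$ times the second one is
  $\omega^2T_0+T_1+\omega T_2$. Hence it suffices to evaluate $T_0+\omega^2T_2$ and
  $T_0+2\omega T_1+\omega^2T_2$, and both are infinite products because each of them is, up to a sixth
  root of unity, the value at $x=\omega$ of a one-parameter family:
  $$\sum_n \frac{(-x;q)_n(-q^2/x;q^2)_n}{(x^2q;q^2)_n(q^3;q^3)_n}x^nq^{n(n+1)/2}
     = \frac{(-xq;q^2)_\infty(-x^3q^3;q^6)_\infty}{(x^2q;q^2)_\infty(q^3;q^6)_\infty}$$
  in the first case, and in the second one a family with the factors $(-1/x;q^2)_n x^n/(xq;q)_n$ and otherwise fixed $\omega$.
  Each family satisfies a first-order $q$-difference equation under $x \mapsto xq^2$. Iterating it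
  down to $x = 0$ determines the sum up to a constant, and the constant is read off at $x=-1$, where
  the series reduces to its first term. The two products are
  $J_{5,12} \mp qJ_{1,12}$ up to the common denominator, by the Jacobi triple product and the
  splitting of a theta series into its even and odd terms.
\<close>

section \<open>The $q$-shifted factorials\<close>

text \<open>Both right-hand sides are halves of one object: for s = 1 or s = -1, a bilateral theta
  series in base \<open>- (q ^ 3)\<close> has even part \<open>J2 5 12 q\<close> and odd part
  \<open>- s * q * J2 1 12 q\<close>. Hence the sum and the difference of the halves are what the
  summations deliver, and the two series come out of a 2 by 2 linear system. At x = w neither family
  terminates, so \<open>w\<close> is freed to reach the terminating point -1. In the first family
  every explicit \<open>w\<close> becomes x and \<open>(q^3;q^3)_n\<close> stays. In the second,
  \<open>(q^3;q^3)_n\<close> is split into \<open>(q;q)_n (wq;q)_n (w^2q;q)_n\<close>, and only the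
  middle factor and the numerator factor \<open>w^n (-w^2;q^2)_n\<close> are freed; its recurrence
  needs the relation w^2 + w + 1 = 0 for the \<open>w\<close> that remain. Everything takes place in
  the closed disc norm x <= 1. It contains w, -1 and the limit 0, is stable under x -> x q^2, and no
  denominator \<open>(x^2q;q^2)_n\<close> or \<open>(xq;q)_n\<close> vanishes on it. Bounds uniform
  on this disc justify the limit x -> 0 term by term.\<close>

lemma qpoch_0 [simp]: "qpoch a p 0 = 1"
  by (simp add: qpoch_def)

lemma qpoch_Suc: "qpoch a p (Suc n) = qpoch a p n * (1 - a * p ^ n)"
  by (simp add: qpoch_def)

lemma qpoch_Suc_left: "qpoch a p (Suc n) = (1 - a) * qpoch (a * p) p n"
  unfolding qpoch_def by (subst prod.lessThan_Suc_shift) (simp add: mult.assoc)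

lemma qpoch_mult_minus: "qpoch a p n * qpoch (- a) p n = qpoch (a ^ 2) (p ^ 2) n"
  unfolding qpoch_def prod.distrib [symmetric]
  by (intro prod.cong) (auto simp: power2_eq_square algebra_simps power_mult_distrib)

lemma norm_mult_power_less_1:
  fixes a p :: complex
  assumes "norm a < 1" "norm p \<le> 1"
  shows "norm (a * p ^ n) < 1"
proof -
  have "norm (a * p ^ n) \<le> norm a * 1"
    unfolding norm_mult norm_power using assms by (intro mult_left_mono power_le_one) auto
  thus ?thesis using assms by simp
qed

lemma one_minus_nz: "norm (z :: complex) < 1 \<Longrightarrow> 1 - z \<noteq> 0"
  by auto

lemma qpoch_nz: "norm a < 1 \<Longrightarrow> norm p \<le> 1 \<Longrightarrow> qpoch a p n \<noteq> 0"
  unfolding qpoch_def using norm_mult_power_less_1 one_minus_nz by simp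

lemma summable_norm_geometric:
  assumes "norm (p :: complex) < 1"
  shows "summable (\<lambda>k. norm (a * p ^ k))"
  using assms by (simp add: norm_mult norm_power)

lemma convergent_prod_qpoch:
  assumes "norm p < 1"
  shows "convergent_prod (\<lambda>k. 1 - a * p ^ k :: complex)"
  using summable_norm_geometric [OF assms, of a]
  by (intro abs_convergent_prod_imp_convergent_prod summable_imp_abs_convergent_prod) simp

lemma qpoch_tendsto:
  assumes "norm p < 1"
  shows "qpoch a p \<longlonglongrightarrow> qpoch_inf a p"
proof -
  have "(\<lambda>n. qpoch a p (Suc n)) \<longlonglongrightarrow> qpoch_inf a p"
    using convergent_prod_LIMSEQ [OF convergent_prod_qpoch [OF assms, of a]]
    unfolding qpoch_def qpoch_inf_def lessThan_Suc_atMost .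
  thus ?thesis by (simp only: filterlim_sequentially_Suc)
qed

lemma qpoch_inf_eqI: "norm p < 1 \<Longrightarrow> qpoch a p \<longlonglongrightarrow> l \<Longrightarrow> qpoch_inf a p = l"
  using qpoch_tendsto LIMSEQ_unique by blast

lemma qpoch_tendsto_mult:
  assumes "norm p < 1" "m > 0"
  shows "(\<lambda>n. qpoch a p (m * n)) \<longlonglongrightarrow> qpoch_inf a p"
proof -
  have "filterlim (\<lambda>n. m * n) sequentially sequentially"
    using assms(2) by (simp add: mult_nat_left_at_top)
  from filterlim_compose [OF qpoch_tendsto [OF assms(1)] this] show ?thesis .
qed

lemma qpoch_inf_nz:
  assumes "norm a < 1" "norm p < 1"
  shows "qpoch_inf a p \<noteq> 0"
  unfolding qpoch_inf_def
  using assms norm_mult_power_less_1 one_minus_nz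
  by (intro prodinf_nonzero convergent_prod_qpoch) auto

lemma qpoch_inf_0 [simp]: "qpoch_inf 0 p = 1"
  by (simp add: qpoch_inf_def)

lemma norm_power_less_1: "norm (p :: complex) < 1 \<Longrightarrow> n > 0 \<Longrightarrow> norm (p ^ n) < 1"
  by (simp add: norm_power power_less_one_iff)

text \<open>The factors are sorted by the residue of the exponent modulo \<open>m\<close>.\<close>

lemma qpoch_mult_index: "qpoch a p (m * n) = (\<Prod>i<m. qpoch (a * p ^ i) (p ^ m) n)"
proof (induction n)
  case (Suc n)
  have "qpoch a p (k + j) = qpoch a p k * (\<Prod>i<j. 1 - a * p ^ (k + i))" for k j
    by (induction j) (simp_all add: qpoch_Suc)
  from this [of "m * n" m] Suc show ?case
    by (simp add: qpoch_Suc prod.distrib power_add power_mult mult_ac add.commute)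
qed simp

lemma qpoch_inf_split:
  assumes "norm p < 1" "m > 0"
  shows "qpoch_inf a p = (\<Prod>i<m. qpoch_inf (a * p ^ i) (p ^ m))"
proof (rule LIMSEQ_unique)
  show "(\<lambda>n. qpoch a p (m * n)) \<longlonglongrightarrow> qpoch_inf a p"
    by (rule qpoch_tendsto_mult [OF assms])
  show "(\<lambda>n. qpoch a p (m * n)) \<longlonglongrightarrow> (\<Prod>i<m. qpoch_inf (a * p ^ i) (p ^ m))"
    unfolding qpoch_mult_index using assms
    by (intro tendsto_prod qpoch_tendsto norm_power_less_1)
qed

lemma qpoch_inf_split2:
  "norm p < 1 \<Longrightarrow> qpoch_inf a p = qpoch_inf a (p ^ 2) * qpoch_inf (a * p) (p ^ 2)"
  by (subst qpoch_inf_split [where m = 2]) (simp_all add: numeral_2_eq_2)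

lemma qpoch_inf_split3:
  "norm p < 1 \<Longrightarrow>
     qpoch_inf a p = qpoch_inf a (p ^ 3) * qpoch_inf (a * p) (p ^ 3) * qpoch_inf (a * p ^ 2) (p ^ 3)"
  by (subst qpoch_inf_split [where m = 3]) (simp_all add: eval_nat_numeral)

lemma qpoch_inf_mult_minus:
  assumes "norm p < 1"
  shows "qpoch_inf a p * qpoch_inf (- a) p = qpoch_inf (a ^ 2) (p ^ 2)"
proof (rule qpoch_inf_eqI [symmetric])
  show "qpoch (a ^ 2) (p ^ 2) \<longlonglongrightarrow> qpoch_inf a p * qpoch_inf (- a) p"
    unfolding qpoch_mult_minus [symmetric] by (intro tendsto_mult qpoch_tendsto assms)
qed (use assms norm_power_less_1 in auto)

text \<open>Bounds that are uniform in the length of the product; they supply the dominating series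
  for Tannery's theorem.\<close>

lemma norm_qpoch_le:
  assumes "norm a \<le> s" "norm p < 1"
  shows "norm (qpoch a p n) \<le> exp (s / (1 - norm p))"
proof -
  have s: "s \<ge> 0" using assms(1) norm_ge_zero order_trans by blast
  have "norm (qpoch a p n) \<le> (\<Prod>k<n. 1 + s * norm p ^ k)"
    unfolding qpoch_def prod_norm [symmetric]
  proof (intro prod_mono conjI norm_ge_zero)
    fix k
    have "norm (1 - a * p ^ k) \<le> 1 + norm a * norm p ^ k"
      using norm_triangle_ineq4 [of 1 "a * p ^ k"] by (simp add: norm_mult norm_power)
    also have "\<dots> \<le> 1 + s * norm p ^ k" using assms by (intro add_mono mult_right_mono) auto
    finally show "norm (1 - a * p ^ k) \<le> 1 + s * norm p ^ k" .
  qed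
  also have "\<dots> \<le> exp (\<Sum>k<n. s * norm p ^ k)"
    using s by (intro prod_le_exp_sum) auto
  also have "(\<Sum>k<n. s * norm p ^ k) \<le> (\<Sum>k. s * norm p ^ k)"
    using s assms by (intro sum_le_suminf) auto
  also have "(\<Sum>k. s * norm p ^ k) = s / (1 - norm p)"
    using assms by (subst suminf_mult) (auto simp: suminf_geometric)
  finally show ?thesis by simp
qed

text \<open>Since 1/(1-t) = 1 + t/(1-t) <= 1 + t/(1-s) for 0 <= t <= s, each reciprocal factor again
  has the shape 1 + C * norm p ^ k. The bound depends on \<open>a\<close> only through
  \<open>s\<close>, which makes it uniform over a disc.\<close>

lemma norm_inverse_qpoch_le:
  assumes "norm a \<le> s" "s < 1" "norm p < 1"
  shows "norm (inverse (qpoch a p n)) \<le> exp (s / (1 - s) / (1 - norm p))"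
proof -
  have s: "s \<ge> 0" using assms(1) norm_ge_zero order_trans by blast
  have "norm (inverse (qpoch a p n)) \<le> (\<Prod>k<n. 1 + s / (1 - s) * norm p ^ k)"
    unfolding qpoch_def prod_inversef [symmetric] prod_norm [symmetric] o_def
  proof (intro prod_mono conjI norm_ge_zero)
    fix k
    define t where "t = s * norm p ^ k"
    have t: "0 \<le> t" "t \<le> s"
      using s assms by (auto simp: t_def power_le_one mult_left_le)
    have "norm (a * p ^ k) \<le> t" unfolding t_def using assms
      by (simp add: norm_mult norm_power mult_right_mono)
    hence "1 - t \<le> norm (1 - a * p ^ k)"
      using norm_triangle_ineq2 [of 1 "a * p ^ k"] by simp
    hence "norm (inverse (1 - a * p ^ k)) \<le> inverse (1 - t)"
      unfolding norm_inverse using t assms by (intro le_imp_inverse_le) auto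
    also have "\<dots> = 1 + t / (1 - t)" using t assms by (simp add: field_simps)
    also have "\<dots> \<le> 1 + t / (1 - s)"
      using t assms by (intro add_left_mono divide_left_mono) auto
    finally show "norm (inverse (1 - a * p ^ k)) \<le> 1 + s / (1 - s) * norm p ^ k"
      by (simp add: t_def)
  qed
  also have "\<dots> \<le> exp (\<Sum>k<n. s / (1 - s) * norm p ^ k)"
    using s assms by (intro prod_le_exp_sum) auto
  also have "(\<Sum>k<n. s / (1 - s) * norm p ^ k) \<le> (\<Sum>k. s / (1 - s) * norm p ^ k)"
    using s assms by (intro sum_le_suminf) auto
  also have "(\<Sum>k. s / (1 - s) * norm p ^ k) = s / (1 - s) / (1 - norm p)"
    using assms by (subst suminf_mult) (auto simp: suminf_geometric)
  finally show ?thesis by simp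
qed

section \<open>A cubic summation\<close>

text \<open>The factor \<^term>\<open>(\<Prod>j<n. x + q ^ (2 * j + 2))\<close> is
  $x^n(-q^2/x;q^2)_n$ in a form that makes sense at $x = 0$.\<close>

definition cubic_term :: "complex \<Rightarrow> complex \<Rightarrow> nat \<Rightarrow> complex" where
  "cubic_term q x n = qpoch (- x) q n * (\<Prod>j<n. x + q ^ (2 * j + 2)) * q ^ (n * (n + 1) div 2)
     / (qpoch (x ^ 2 * q) (q ^ 2) n * qpoch (q ^ 3) (q ^ 3) n)"

lemma triangle_power_Suc: "(q :: complex) ^ (Suc n * (Suc n + 1) div 2) = q ^ (n * (n + 1) div 2) * q ^ n * q"
proof -
  have "Suc n * (Suc n + 1) div 2 = n * (n + 1) div 2 + Suc n" by simp
  thus ?thesis by (simp only: power_add power_Suc) (simp add: mult_ac)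
qed

lemma prod_add_power_shift:
  fixes x q :: complex
  shows "(\<Prod>j<Suc n. x * q ^ 2 + q ^ (2 * j + 2)) = q ^ (2 * Suc n) * (x + 1) * (\<Prod>j<n. x + q ^ (2 * j + 2))"
proof -
  have "(\<Prod>j<Suc n. x * q ^ 2 + q ^ (2 * j + 2)) = (\<Prod>j<Suc n. q ^ 2 * (x + q ^ (2 * j)))"
    by (intro prod.cong) (auto simp: power_add algebra_simps power2_eq_square)
  also have "\<dots> = q ^ (2 * Suc n) * (\<Prod>j<Suc n. x + q ^ (2 * j))"
    by (simp only: prod.distrib prod_constant card_lessThan power_mult)
  also have "(\<Prod>j<Suc n. x + q ^ (2 * j)) = (x + 1) * (\<Prod>j<n. x + q ^ (2 * j + 2))"
    by (subst prod.lessThan_Suc_shift) simp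
  finally show ?thesis by (simp add: mult_ac)
qed

text \<open>Partial sums of the $q$-difference operator in $x \mapsto x q^2$ that annihilates the series,
  found by creative telescoping.\<close>

definition cubic_cert :: "complex \<Rightarrow> complex \<Rightarrow> nat \<Rightarrow> complex" where
  "cubic_cert q x n = (1 - x ^ 2 * q) * (1 - x ^ 2 * q ^ 3) * cubic_term q x n
     * ((1 + x * q ^ n) * q * q ^ n * x * (1 + x * q ^ 2 * q ^ n))
     / ((1 - x ^ 2 * q * q ^ (2 * n)) * (1 - x ^ 2 * q ^ 3 * q ^ (2 * n)))"

text \<open>The telescoping step divided by the factor common to all its terms, with
  \<open>Q\<close> standing for \<open>q ^ n\<close>. What remains is the certificate identity
  between rational functions. The factor \<open>1 - x ^ 2 * q * Q ^ 2\<close> occurs once in every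
  denominator, so it is absent from the polynomial identity obtained by clearing
  denominators.\<close>

lemma cubic_rational_identity:
  fixes x q Q :: complex
  assumes "1 - x ^ 2 * q * Q ^ 2 \<noteq> 0" "1 - x ^ 2 * q ^ 3 * Q ^ 2 \<noteq> 0"
    "1 - x ^ 2 * q ^ 5 * Q ^ 2 \<noteq> 0" "1 - q ^ 3 * Q ^ 3 \<noteq> 0"
  shows "(1 + x ^ 3 * q ^ 3) * ((1 + x * q * Q) * (1 + x * q ^ 2 * Q) * q ^ 3 * Q ^ 3)
           / ((1 - q ^ 3 * Q ^ 3) * (1 - x ^ 2 * q * Q ^ 2) * (1 - x ^ 2 * q ^ 3 * Q ^ 2) * (1 - x ^ 2 * q ^ 5 * Q ^ 2))
         - (x + q ^ 2 * Q ^ 2) * q * Q / ((1 - x ^ 2 * q * Q ^ 2) * (1 - q ^ 3 * Q ^ 3))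
       = (x + q ^ 2 * Q ^ 2) * q * Q / ((1 - x ^ 2 * q * Q ^ 2) * (1 - q ^ 3 * Q ^ 3))
           * ((1 + x * q * Q) * q * (q * Q) * x * (1 + x * q ^ 2 * (q * Q)))
           / ((1 - x ^ 2 * q ^ 3 * Q ^ 2) * (1 - x ^ 2 * q ^ 5 * Q ^ 2))
         - q * Q * x * (1 + x * q ^ 2 * Q) / ((1 - x ^ 2 * q * Q ^ 2) * (1 - x ^ 2 * q ^ 3 * Q ^ 2))"
proof -
  define a where "a = 1 - x ^ 2 * q * Q ^ 2"
  define b where "b = 1 - x ^ 2 * q ^ 3 * Q ^ 2"
  define c where "c = 1 - x ^ 2 * q ^ 5 * Q ^ 2"
  define d where "d = 1 - q ^ 3 * Q ^ 3"
  have nz: "a \<noteq> 0" "b \<noteq> 0" "c \<noteq> 0" "d \<noteq> 0"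
    using assms by (simp_all add: a_def b_def c_def d_def)
  have "(1 + x ^ 3 * q ^ 3) * ((1 + x * q * Q) * (1 + x * q ^ 2 * Q) * q ^ 3 * Q ^ 3)
          - (x + q ^ 2 * Q ^ 2) * q * Q * b * c
      = (x + q ^ 2 * Q ^ 2) * q * Q * ((1 + x * q * Q) * q * (q * Q) * x * (1 + x * q ^ 2 * (q * Q)))
          - q * Q * x * (1 + x * q ^ 2 * Q) * c * d"
    unfolding b_def c_def d_def by algebra
  hence "((1 + x ^ 3 * q ^ 3) * ((1 + x * q * Q) * (1 + x * q ^ 2 * Q) * q ^ 3 * Q ^ 3)
          - (x + q ^ 2 * Q ^ 2) * q * Q * b * c) / (d * a * b * c)
      = ((x + q ^ 2 * Q ^ 2) * q * Q * ((1 + x * q * Q) * q * (q * Q) * x * (1 + x * q ^ 2 * (q * Q)))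
          - q * Q * x * (1 + x * q ^ 2 * Q) * c * d) / (d * a * b * c)"
    by simp
  thus ?thesis
    unfolding a_def [symmetric] b_def [symmetric] c_def [symmetric] d_def [symmetric]
    using nz by (simp add: diff_divide_distrib mult_ac)
qed

context
  fixes q x :: complex
  assumes q: "norm q < 1" and x: "norm x \<le> 1"
begin

lemma norm_x2q: "norm (x ^ 2 * q ^ Suc k) < 1"
proof -
  have "norm (x ^ 2 * q ^ Suc k) \<le> 1 * norm (q ^ Suc k)"
    unfolding norm_mult using x by (intro mult_right_mono) (auto simp: norm_power power_le_one)
  also have "\<dots> < 1" using norm_power_less_1 [OF q, of "Suc k"] by simp
  finally show ?thesis .
qed

lemma one_minus_x2q_nz: "1 - x ^ 2 * q ^ Suc k \<noteq> 0"
  using norm_x2q one_minus_nz by blast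

lemma cubic_telescope_step:
  "(1 + x * q) * (1 + x ^ 3 * q ^ 3) * cubic_term q (x * q ^ 2) (Suc n)
     - (1 - x ^ 2 * q) * (1 - x ^ 2 * q ^ 3) * cubic_term q x (Suc n)
   = cubic_cert q x (Suc n) - cubic_cert q x n"
proof -
  define Q where "Q = q ^ n"
  define b where "b = (\<Prod>j<n. x + q ^ (2 * j + 2))"
  define B where "B = qpoch (x ^ 2 * q) (q ^ 2) n"
  define D where "D = qpoch (q ^ 3) (q ^ 3) n"
  define P where "P = qpoch (- x * q) q n"
  define t where "t = q ^ (n * (n + 1) div 2)"
  \<comment> \<open>The common factor: the terms of index n + 1, at x and at x q^2, are rational
    multiples of \<open>c\<close> up to the coefficient \<open>1 + x * q\<close> of the
    operator.\<close>
  define c where "c = (1 + x) * P * b * t / (B * D)"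
  have Q2: "(q ^ 2) ^ n = Q ^ 2" "(q ^ 3) ^ n = Q ^ 3" "q ^ (2 * n) = Q ^ 2"
    by (simp_all add: Q_def power_mult [symmetric] mult.commute)
  have nz1: "1 - x ^ 2 * q * Q ^ 2 \<noteq> 0"
    using one_minus_x2q_nz [of "2 * n"] by (simp add: Q_def power_mult [symmetric] mult_ac)
  have nz3: "1 - x ^ 2 * q ^ 3 * Q ^ 2 \<noteq> 0"
    using one_minus_x2q_nz [of "2 * n + 2"]
    by (simp add: Q_def power_mult [symmetric] mult_ac power_add eval_nat_numeral)
  have nz5: "1 - x ^ 2 * q ^ 5 * Q ^ 2 \<noteq> 0"
    using one_minus_x2q_nz [of "2 * n + 4"]
    by (simp add: Q_def power_mult [symmetric] mult_ac power_add eval_nat_numeral)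
  have e1: "1 - x ^ 2 * q \<noteq> 0" and e3: "1 - x ^ 2 * q ^ 3 \<noteq> 0"
    using one_minus_x2q_nz [of 0] one_minus_x2q_nz [of 2] by (simp_all add: eval_nat_numeral)
  have nzq: "1 - q ^ 3 * Q ^ 3 \<noteq> 0"
    using one_minus_nz [OF norm_power_less_1 [OF q, of "3 * n + 3"]]
    by (simp add: Q_def power_mult [symmetric] mult_ac power_add)
  have D: "D \<noteq> 0" unfolding D_def
    by (intro qpoch_nz norm_power_less_1 q less_imp_le) auto
  have B: "B \<noteq> 0" unfolding B_def
    using norm_x2q [of 0] by (intro qpoch_nz norm_power_less_1 q less_imp_le) auto
  have P0: "qpoch (- x) q (Suc n) = (1 + x) * P"
    by (simp add: qpoch_Suc_left P_def)
  have P2: "qpoch (- x) q (Suc (Suc n)) = (1 + x) * P * (1 + x * q * Q)"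
    by (subst qpoch_Suc) (simp add: P0 Q_def mult_ac)
  have P3: "qpoch (- x) q (Suc (Suc (Suc n))) = (1 + x) * P * (1 + x * q * Q) * (1 + x * q ^ 2 * Q)"
    by (subst qpoch_Suc) (simp add: P2 Q_def mult_ac power2_eq_square)
  have Pq: "(1 + x * q) * qpoch (- (x * q ^ 2)) q (Suc n) = P * (1 + x * q * Q) * (1 + x * q ^ 2 * Q)"
  proof -
    have "(1 + x * q) * qpoch (- (x * q ^ 2)) q (Suc n) = qpoch (- x * q) q (Suc (Suc n))"
      by (subst (2) qpoch_Suc_left) (simp add: power2_eq_square mult_ac)
    also have "\<dots> = P * (1 + x * q * Q) * (1 + x * q ^ 2 * Q)"
      by (simp add: qpoch_Suc P_def Q_def power2_eq_square mult_ac)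
    finally show ?thesis .
  qed
  have B1: "qpoch (x ^ 2 * q) (q ^ 2) (Suc n) = B * (1 - x ^ 2 * q * Q ^ 2)"
    by (simp add: qpoch_Suc B_def Q2)
  \<comment> \<open>Replacing x by x q^2 multiplies x^2 q by q^4, that is, it skips two factors in
    base q^2. So the factorial is read off from the one of length n + 3 that starts at x^2
    q.\<close>
  have Bq: "qpoch ((x * q ^ 2) ^ 2 * q) (q ^ 2) (Suc n)
      = B * (1 - x ^ 2 * q * Q ^ 2) * (1 - x ^ 2 * q ^ 3 * Q ^ 2) * (1 - x ^ 2 * q ^ 5 * Q ^ 2)
          / ((1 - x ^ 2 * q) * (1 - x ^ 2 * q ^ 3))"
  proof -
    have "qpoch (x ^ 2 * q) (q ^ 2) (Suc (Suc (Suc n)))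
        = (1 - x ^ 2 * q) * ((1 - x ^ 2 * q ^ 3) * qpoch ((x * q ^ 2) ^ 2 * q) (q ^ 2) (Suc n))"
      by (subst qpoch_Suc_left, subst qpoch_Suc_left)
         (simp add: power_mult_distrib power_mult [symmetric] mult_ac eval_nat_numeral)
    moreover have "qpoch (x ^ 2 * q) (q ^ 2) (Suc (Suc (Suc n)))
        = B * (1 - x ^ 2 * q * Q ^ 2) * (1 - x ^ 2 * q ^ 3 * Q ^ 2) * (1 - x ^ 2 * q ^ 5 * Q ^ 2)"
      by (simp add: qpoch_Suc B_def Q2) (simp add: eval_nat_numeral mult_ac)
    ultimately have *: "qpoch ((x * q ^ 2) ^ 2 * q) (q ^ 2) (Suc n) * ((1 - x ^ 2 * q) * (1 - x ^ 2 * q ^ 3))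
        = B * (1 - x ^ 2 * q * Q ^ 2) * (1 - x ^ 2 * q ^ 3 * Q ^ 2) * (1 - x ^ 2 * q ^ 5 * Q ^ 2)"
      by (simp only: mult_ac)
    show ?thesis by (subst * [symmetric]) (use e1 e3 in simp)
  qed
  have D1: "qpoch (q ^ 3) (q ^ 3) (Suc n) = D * (1 - q ^ 3 * Q ^ 3)"
    by (simp add: qpoch_Suc D_def Q2)
  have t1: "q ^ (Suc n * (Suc n + 1) div 2) = t * (q * Q)"
    unfolding triangle_power_Suc by (simp add: t_def Q_def)
  have b1: "(\<Prod>j<Suc n. x + q ^ (2 * j + 2)) = b * (x + q ^ 2 * Q ^ 2)"
  proof -
    have "q ^ (2 * n + 2) = q ^ 2 * Q ^ 2" unfolding power_add Q2 by (rule mult.commute)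
    thus ?thesis by (simp only: prod.lessThan_Suc b_def)
  qed
  have bq: "(\<Prod>j<Suc n. x * q ^ 2 + q ^ (2 * j + 2)) = q ^ 2 * Q ^ 2 * (x + 1) * b"
  proof -
    have "q ^ (2 * Suc n) = q ^ (2 * n + 2)" by simp
    also have "\<dots> = q ^ 2 * Q ^ 2" unfolding power_add Q2 by (rule mult.commute)
    finally show ?thesis unfolding prod_add_power_shift b_def by simp
  qed
  \<comment> \<open>This is not solved for the term itself, because \<open>1 + x * Q\<close>
    vanishes at x = -1, n = 0. The certificate contains this factor, so the product is all that is
    required.\<close>
  have F0: "(1 + x * Q) * cubic_term q x n = c"
  proof -
    have "(1 + x * Q) * qpoch (- x) q n = (1 + x) * P"
      unfolding P0 [symmetric] by (simp add: qpoch_Suc Q_def mult_ac)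
    thus ?thesis unfolding cubic_term_def c_def
      by (simp add: b_def B_def D_def t_def mult_ac)
  qed
  have F1: "cubic_term q x (Suc n) = c * ((x + q ^ 2 * Q ^ 2) * q * Q / ((1 - x ^ 2 * q * Q ^ 2) * (1 - q ^ 3 * Q ^ 3)))"
    unfolding cubic_term_def P0 B1 D1 t1 b1 c_def by (simp add: mult_ac)
  have Fq: "(1 + x * q) * cubic_term q (x * q ^ 2) (Suc n)
      = (1 - x ^ 2 * q) * (1 - x ^ 2 * q ^ 3) * c * ((1 + x * q * Q) * (1 + x * q ^ 2 * Q) * q ^ 3 * Q ^ 3
           / ((1 - q ^ 3 * Q ^ 3) * (1 - x ^ 2 * q * Q ^ 2) * (1 - x ^ 2 * q ^ 3 * Q ^ 2) * (1 - x ^ 2 * q ^ 5 * Q ^ 2)))"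
  proof -
    have "(1 + x * q) * cubic_term q (x * q ^ 2) (Suc n)
        = ((1 + x * q) * qpoch (- (x * q ^ 2)) q (Suc n)) * (q ^ 2 * Q ^ 2 * (x + 1) * b) * (t * (q * Q))
          / (qpoch ((x * q ^ 2) ^ 2 * q) (q ^ 2) (Suc n) * (D * (1 - q ^ 3 * Q ^ 3)))"
      unfolding cubic_term_def bq t1 D1 by (simp add: mult_ac)
    also have "\<dots> = (1 - x ^ 2 * q) * (1 - x ^ 2 * q ^ 3) * c * ((1 + x * q * Q) * (1 + x * q ^ 2 * Q) * q ^ 3 * Q ^ 3
           / ((1 - q ^ 3 * Q ^ 3) * (1 - x ^ 2 * q * Q ^ 2) * (1 - x ^ 2 * q ^ 3 * Q ^ 2) * (1 - x ^ 2 * q ^ 5 * Q ^ 2)))"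
      unfolding Pq Bq c_def by (simp add: eval_nat_numeral mult_ac add_ac)
    finally show ?thesis .
  qed
  define e where "e = (1 - x ^ 2 * q) * (1 - x ^ 2 * q ^ 3) * c"
  have C0: "cubic_cert q x n = e * (q * Q * x * (1 + x * q ^ 2 * Q)
              / ((1 - x ^ 2 * q * Q ^ 2) * (1 - x ^ 2 * q ^ 3 * Q ^ 2)))"
    unfolding cubic_cert_def Q2 e_def F0 [symmetric] by (simp add: Q_def mult_ac)
  have C1: "cubic_cert q x (Suc n) = e * ((x + q ^ 2 * Q ^ 2) * q * Q / ((1 - x ^ 2 * q * Q ^ 2) * (1 - q ^ 3 * Q ^ 3))
           * ((1 + x * q * Q) * q * (q * Q) * x * (1 + x * q ^ 2 * (q * Q)))
           / ((1 - x ^ 2 * q ^ 3 * Q ^ 2) * (1 - x ^ 2 * q ^ 5 * Q ^ 2)))"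
  proof -
    have "q ^ (2 * Suc n) = q ^ (2 * n + 2)" by simp
    also have "\<dots> = q ^ 2 * Q ^ 2" unfolding power_add Q2 by (rule mult.commute)
    finally have "q ^ (2 * Suc n) = q ^ 2 * Q ^ 2" .
    moreover have "q ^ Suc n = q * Q" by (simp add: Q_def)
    ultimately have "cubic_cert q x (Suc n) = (1 - x ^ 2 * q) * (1 - x ^ 2 * q ^ 3) * cubic_term q x (Suc n)
       * ((1 + x * (q * Q)) * q * (q * Q) * x * (1 + x * q ^ 2 * (q * Q)))
       / ((1 - x ^ 2 * q * (q ^ 2 * Q ^ 2)) * (1 - x ^ 2 * q ^ 3 * (q ^ 2 * Q ^ 2)))"
      by (simp only: cubic_cert_def)
    moreover have "x ^ 2 * q * (q ^ 2 * Q ^ 2) = x ^ 2 * q ^ 3 * Q ^ 2" by algebra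
    moreover have "x ^ 2 * q ^ 3 * (q ^ 2 * Q ^ 2) = x ^ 2 * q ^ 5 * Q ^ 2" by algebra
    ultimately show ?thesis unfolding F1 e_def by (simp add: mult_ac)
  qed
  have "(1 + x * q) * (1 + x ^ 3 * q ^ 3) * cubic_term q (x * q ^ 2) (Suc n)
     - (1 - x ^ 2 * q) * (1 - x ^ 2 * q ^ 3) * cubic_term q x (Suc n)
   = e * ((1 + x ^ 3 * q ^ 3) * ((1 + x * q * Q) * (1 + x * q ^ 2 * Q) * q ^ 3 * Q ^ 3)
           / ((1 - q ^ 3 * Q ^ 3) * (1 - x ^ 2 * q * Q ^ 2) * (1 - x ^ 2 * q ^ 3 * Q ^ 2) * (1 - x ^ 2 * q ^ 5 * Q ^ 2))
         - (x + q ^ 2 * Q ^ 2) * q * Q / ((1 - x ^ 2 * q * Q ^ 2) * (1 - q ^ 3 * Q ^ 3)))"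
    using arg_cong [OF Fq, of "\<lambda>z. (1 + x ^ 3 * q ^ 3) * z"] unfolding F1 e_def
    by (simp add: right_diff_distrib mult_ac)
  also have "\<dots> = cubic_cert q x (Suc n) - cubic_cert q x n"
    unfolding cubic_rational_identity [OF nz1 nz3 nz5 nzq] C0 C1 by (simp only: right_diff_distrib)
  finally show ?thesis .
qed

text \<open>There is no boundary term: at n = 0 the certificate already equals the difference of the
  two coefficients of the operator. So the recurrence for the full sums is homogeneous once the
  certificate tends to 0.\<close>

lemma cubic_telescope:
  "(\<Sum>k<Suc n. (1 + x * q) * (1 + x ^ 3 * q ^ 3) * cubic_term q (x * q ^ 2) k
     - (1 - x ^ 2 * q) * (1 - x ^ 2 * q ^ 3) * cubic_term q x k) = cubic_cert q x n"
proof (induction n)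
  case 0
  have "1 - x ^ 2 * q \<noteq> 0" "1 - x ^ 2 * q ^ 3 \<noteq> 0"
    using one_minus_x2q_nz [of 0] one_minus_x2q_nz [of 2] by (simp_all add: eval_nat_numeral)
  hence "cubic_cert q x 0 = (1 + x) * q * x * (1 + x * q ^ 2)"
    by (simp add: cubic_cert_def cubic_term_def)
  also have "\<dots> = (1 + x * q) * (1 + x ^ 3 * q ^ 3) - (1 - x ^ 2 * q) * (1 - x ^ 2 * q ^ 3)"
    by algebra
  finally show ?case by (simp add: cubic_term_def)
next
  case (Suc n)
  show ?case by (subst sum.lessThan_Suc, subst Suc.IH, subst cubic_telescope_step) simp
qed

end

section \<open>Uniform bounds and the limit x -> 0\<close>

lemma suminf_tendsto_0:
  fixes F :: "complex \<Rightarrow> nat \<Rightarrow> complex"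
  assumes bound: "\<And>x n. norm x \<le> 1 \<Longrightarrow> norm (F x n) \<le> K * r ^ n"
    and r: "0 \<le> r" "r < 1"
    and cont: "\<And>n. isCont (\<lambda>x. F x n) 0"
    and y: "y \<longlonglongrightarrow> 0" "\<And>m. norm (y m) \<le> 1"
  shows "(\<lambda>m. suminf (F (y m))) \<longlonglongrightarrow> suminf (F 0)"
proof -
  \<comment> \<open>The hypothesis of Tannery's theorem: one convergent geometric majorant valid for
    all the points \<open>y m\<close> at once.\<close>
  have "eventually (\<lambda>(n, m). norm (F (y m) n) \<le> K * r ^ n) (at_top \<times>\<^sub>F sequentially)"
    using bound y(2) by (intro always_eventually) auto
  moreover have "summable (\<lambda>n. K * r ^ n)"
    using r by (intro summable_mult summable_geometric) auto
  moreover have "(\<lambda>m. F (y m) n) \<longlonglongrightarrow> F 0 n" for n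
    using isCont_tendsto_compose [OF cont y(1)] .
  ultimately show ?thesis
    using tannerys_theorem [of "\<lambda>n m. F (y m) n" "F 0" sequentially "\<lambda>n. K * r ^ n"] by simp
qed

lemma sums_first_term:
  fixes f :: "nat \<Rightarrow> complex"
  assumes "\<And>n. f (Suc n) = 0"
  shows "f sums f 0"
proof -
  have "f sums sum f {0}"
  proof (rule sums_finite)
    fix n :: nat assume "n \<notin> {0}"
    thus "f n = 0" using assms by (cases n) auto
  qed auto
  thus ?thesis by simp
qed

lemma isCont_qpoch [continuous_intros]:
  assumes "isCont f x"
  shows "isCont (\<lambda>x. qpoch (f x) p n) x"
  using assms unfolding qpoch_def isCont_def
  by (intro tendsto_prod tendsto_diff tendsto_mult tendsto_const)

lemma norm_prod_add_le:
  fixes x q :: complex and e :: "nat \<Rightarrow> nat"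
  assumes "norm x \<le> 1" "norm q < 1" "\<And>j. j \<le> e j"
  shows "norm (\<Prod>j<n. x + q ^ e j) \<le> exp (1 / (1 - norm q))"
proof -
  have "norm (\<Prod>j<n. x + q ^ e j) \<le> (\<Prod>j<n. 1 + norm q ^ j)"
    unfolding prod_norm [symmetric]
  proof (intro prod_mono conjI norm_ge_zero)
    fix j
    have "norm (x + q ^ e j) \<le> norm x + norm q ^ e j"
      using norm_triangle_ineq [of x "q ^ e j"] by (simp add: norm_power)
    also have "\<dots> \<le> 1 + norm q ^ j"
      using assms by (intro add_mono power_decreasing) auto
    finally show "norm (x + q ^ e j) \<le> 1 + norm q ^ j" .
  qed
  also have "\<dots> \<le> exp (\<Sum>j<n. norm q ^ j)"
    by (intro prod_le_exp_sum) auto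
  also have "(\<Sum>j<n. norm q ^ j) \<le> (\<Sum>j. norm q ^ j)"
    using assms by (intro sum_le_suminf) auto
  also have "(\<Sum>j. norm q ^ j) = 1 / (1 - norm q)"
    using assms by (simp add: suminf_geometric)
  finally show ?thesis by simp
qed

lemma norm_triangle_power_le:
  assumes "norm (q :: complex) < 1"
  shows "norm (q ^ (n * (n + 1) div 2)) \<le> norm q ^ n"
proof -
  have "n \<le> n * (n + 1) div 2" by (cases n) auto
  thus ?thesis unfolding norm_power using assms by (intro power_decreasing) auto
qed

text \<open>The constant is chosen before \<open>x\<close> and \<open>n\<close>, as a majorant
  uniform on the disc demands. The geometric decay comes from the triangular power of
  \<open>q\<close> alone; all other factors stay bounded.\<close>

lemma cubic_term_bound:
  assumes q: "norm q < 1"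
  obtains K where "\<And>x n. norm x \<le> 1 \<Longrightarrow> norm (cubic_term q x n) \<le> K * norm q ^ n"
proof -
  define r where "r = norm q"
  have r: "0 \<le> r" "r < 1" using q by (auto simp: r_def)
  define K where "K = exp (1 / (1 - r)) * exp (1 / (1 - r))
     * (exp (r / (1 - r) / (1 - norm (q ^ 2))) * exp (norm (q ^ 3) / (1 - norm (q ^ 3)) / (1 - norm (q ^ 3))))"
  have p: "norm (q ^ 2) < 1" "norm (q ^ 3) < 1"
    by (rule norm_power_less_1 [OF q]; simp)+
  have "norm (cubic_term q x n) \<le> K * r ^ n" if x: "norm x \<le> 1" for x n
  proof -
    have x2: "norm (x ^ 2 * q) \<le> r"
      unfolding norm_mult r_def using x by (intro mult_left_le_one_le) (auto simp: norm_power power_le_one)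
    have "norm (cubic_term q x n) = norm (qpoch (- x) q n) * norm (\<Prod>j<n. x + q ^ (2 * j + 2))
        * norm (q ^ (n * (n + 1) div 2))
        * (norm (inverse (qpoch (x ^ 2 * q) (q ^ 2) n)) * norm (inverse (qpoch (q ^ 3) (q ^ 3) n)))"
      by (simp only: cubic_term_def norm_mult divide_inverse inverse_mult_distrib)
    also have "\<dots> \<le> exp (1 / (1 - r)) * exp (1 / (1 - r)) * r ^ n
        * (exp (r / (1 - r) / (1 - norm (q ^ 2))) * exp (norm (q ^ 3) / (1 - norm (q ^ 3)) / (1 - norm (q ^ 3))))"
    proof -
      have "norm (qpoch (- x) q n) \<le> exp (1 / (1 - r))"
        unfolding r_def using x by (intro norm_qpoch_le q) simp
      moreover have "norm (\<Prod>j<n. x + q ^ (2 * j + 2)) \<le> exp (1 / (1 - r))"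
        unfolding r_def by (rule norm_prod_add_le [OF x q]) simp
      moreover have "norm (q ^ (n * (n + 1) div 2)) \<le> r ^ n"
        unfolding r_def by (rule norm_triangle_power_le [OF q])
      moreover have "norm (inverse (qpoch (x ^ 2 * q) (q ^ 2) n)) \<le> exp (r / (1 - r) / (1 - norm (q ^ 2)))"
        by (rule norm_inverse_qpoch_le [OF x2 r(2) p(1)])
      moreover have "norm (inverse (qpoch (q ^ 3) (q ^ 3) n))
          \<le> exp (norm (q ^ 3) / (1 - norm (q ^ 3)) / (1 - norm (q ^ 3)))"
        by (rule norm_inverse_qpoch_le [OF order_refl p(2) p(2)])
      ultimately show ?thesis
        by (intro mult_mono' mult_nonneg_nonneg norm_ge_zero)
    qed
    finally show ?thesis unfolding K_def by (simp only: mult_ac)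
  qed
  thus thesis using that unfolding r_def by blast
qed

lemma summable_cubic_term:
  assumes "norm q < 1" "norm x \<le> 1"
  shows "summable (cubic_term q x)"
proof -
  obtain K where K: "\<And>x n. norm x \<le> 1 \<Longrightarrow> norm (cubic_term q x n) \<le> K * norm q ^ n"
    using cubic_term_bound [OF assms(1)] by blast
  have "summable (\<lambda>n. K * norm q ^ n)"
    using assms(1) by (intro summable_mult summable_geometric) simp
  thus ?thesis by (rule summable_comparison_test') (rule K [OF assms(2)])
qed

lemma norm_mult_q_power_le:
  fixes x q :: complex
  assumes "norm q < 1" "norm x \<le> 1"
  shows "norm (x * q ^ n) \<le> 1"
  unfolding norm_mult norm_power using assms
  by (intro mult_le_one zero_le_power power_le_one norm_ge_zero) simp_all

lemma cubic_cert_tendsto_0: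
  assumes q: "norm q < 1" and x: "norm x \<le> 1"
  shows "cubic_cert q x \<longlonglongrightarrow> 0"
proof -
  have 1: "(\<lambda>n. q ^ n) \<longlonglongrightarrow> 0" using q by (rule LIMSEQ_power_zero)
  have 2: "(\<lambda>n. q ^ (2 * n)) \<longlonglongrightarrow> 0"
    unfolding power_mult using norm_power_less_1 [OF q, of 2] by (intro LIMSEQ_power_zero) auto
  have 0: "cubic_term q x \<longlonglongrightarrow> 0"
    by (rule summable_LIMSEQ_zero [OF summable_cubic_term [OF assms]])
  have "(\<lambda>n. c * f n * ((1 + x * u n) * q * u n * x * (1 + x * q ^ 2 * u n))
            / ((1 - x ^ 2 * q * v n) * (1 - x ^ 2 * q ^ 3 * v n))) \<longlonglongrightarrow> 0"
    if "f \<longlonglongrightarrow> 0" "u \<longlonglongrightarrow> 0" "v \<longlonglongrightarrow> 0" for c :: complex and f u v :: "nat \<Rightarrow> complex"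
    by (rule tendsto_eq_intros that refl | simp)+
  from this [OF 0 1 2] show ?thesis unfolding cubic_cert_def .
qed

lemma cubic_sum_step:
  assumes q: "norm q < 1" and x: "norm x \<le> 1"
  shows "(1 - x ^ 2 * q) * (1 - x ^ 2 * q ^ 3) * suminf (cubic_term q x)
       = (1 + x * q) * (1 + x ^ 3 * q ^ 3) * suminf (cubic_term q (x * q ^ 2))"
proof -
  define c where "c = (\<lambda>k. (1 + x * q) * (1 + x ^ 3 * q ^ 3) * cubic_term q (x * q ^ 2) k
     - (1 - x ^ 2 * q) * (1 - x ^ 2 * q ^ 3) * cubic_term q x k)"
  note sum = summable_sums [OF summable_cubic_term [OF q]]
  have "c sums ((1 + x * q) * (1 + x ^ 3 * q ^ 3) * suminf (cubic_term q (x * q ^ 2))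
     - (1 - x ^ 2 * q) * (1 - x ^ 2 * q ^ 3) * suminf (cubic_term q x))"
    unfolding c_def
    by (rule sums_diff [OF sums_mult [OF sum [OF norm_mult_q_power_le [OF q x]]] sums_mult [OF sum [OF x]]])
  moreover have "(\<lambda>n. sum c {..<Suc n}) \<longlonglongrightarrow> 0"
    using cubic_cert_tendsto_0 [OF q x] unfolding c_def cubic_telescope [OF q x] .
  hence "c sums 0"
    unfolding sums_def by (simp only: filterlim_sequentially_Suc [where f = "\<lambda>n. sum c {..<n}"])
  ultimately show ?thesis by (metis sums_unique2 eq_iff_diff_eq_0)
qed

text \<open>One step at the point x q^(2m) uses up factors 2m and 2m + 1 of the factorial in base
  q^2 on the left, but only one factor of each product on the right; hence the lengths
  \<open>2 * m\<close> and \<open>m\<close>.\<close>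

lemma cubic_sum_iterate:
  assumes q: "norm q < 1" and x: "norm x \<le> 1"
  shows "qpoch (x ^ 2 * q) (q ^ 2) (2 * m) * suminf (cubic_term q x)
       = qpoch (- (x * q)) (q ^ 2) m * qpoch (- (x ^ 3 * q ^ 3)) (q ^ 6) m
           * suminf (cubic_term q (x * q ^ (2 * m)))"
proof (induction m)
  case (Suc m)
  define z where "z = q ^ (2 * m)"
  define y where "y = x * z"
  have y: "norm y \<le> 1" unfolding y_def z_def by (rule norm_mult_q_power_le [OF q x])
  have z: "(q ^ 2) ^ m = z" "(q ^ 2) ^ (2 * m) = z ^ 2" "(q ^ 6) ^ m = z ^ 3"
    by (simp_all add: z_def power_mult [symmetric] mult_ac)
  have "qpoch (x ^ 2 * q) (q ^ 2) (2 * Suc m)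
      = qpoch (x ^ 2 * q) (q ^ 2) (2 * m) * (1 - x ^ 2 * q * z ^ 2) * (1 - x ^ 2 * q * (q ^ 2 * z ^ 2))"
    by (simp only: mult_Suc_right add_2_eq_Suc qpoch_Suc power_Suc z)
  also have "\<dots> = qpoch (x ^ 2 * q) (q ^ 2) (2 * m) * ((1 - y ^ 2 * q) * (1 - y ^ 2 * q ^ 3))"
    unfolding y_def by algebra
  finally have "qpoch (x ^ 2 * q) (q ^ 2) (2 * Suc m) * suminf (cubic_term q x)
      = (1 - y ^ 2 * q) * (1 - y ^ 2 * q ^ 3) * (qpoch (x ^ 2 * q) (q ^ 2) (2 * m) * suminf (cubic_term q x))"
    by (simp only: mult_ac)
  also have "\<dots> = qpoch (- (x * q)) (q ^ 2) m * qpoch (- (x ^ 3 * q ^ 3)) (q ^ 6) m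
         * ((1 - y ^ 2 * q) * (1 - y ^ 2 * q ^ 3) * suminf (cubic_term q y))"
    unfolding Suc.IH y_def z_def by (simp only: mult_ac)
  also have "(1 - y ^ 2 * q) * (1 - y ^ 2 * q ^ 3) * suminf (cubic_term q y)
      = (1 + y * q) * (1 + y ^ 3 * q ^ 3) * suminf (cubic_term q (y * q ^ 2))"
    by (rule cubic_sum_step [OF q y])
  also have "y * q ^ 2 = x * q ^ (2 * Suc m)" by (simp add: y_def z_def power2_eq_square)
  also have "qpoch (- (x * q)) (q ^ 2) m * qpoch (- (x ^ 3 * q ^ 3)) (q ^ 6) m
        * ((1 + y * q) * (1 + y ^ 3 * q ^ 3) * suminf (cubic_term q (x * q ^ (2 * Suc m))))
      = (qpoch (- (x * q)) (q ^ 2) m * (1 - - (x * q) * z))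
        * (qpoch (- (x ^ 3 * q ^ 3)) (q ^ 6) m * (1 - - (x ^ 3 * q ^ 3) * z ^ 3))
        * suminf (cubic_term q (x * q ^ (2 * Suc m)))"
    unfolding y_def by algebra
  finally show ?case by (simp only: qpoch_Suc z)
qed simp

lemma cubic_sum_aux:
  assumes q: "norm q < 1" and x: "norm x \<le> 1"
  shows "qpoch_inf (x ^ 2 * q) (q ^ 2) * suminf (cubic_term q x)
       = qpoch_inf (- (x * q)) (q ^ 2) * qpoch_inf (- (x ^ 3 * q ^ 3)) (q ^ 6) * suminf (cubic_term q 0)"
proof (rule LIMSEQ_unique)
  have p: "norm (q ^ 2) < 1" "norm (q ^ 6) < 1" "norm (q ^ 3) < 1"
    by (rule norm_power_less_1 [OF q]; simp)+
  show "(\<lambda>m. qpoch (x ^ 2 * q) (q ^ 2) (2 * m) * suminf (cubic_term q x))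
     \<longlonglongrightarrow> qpoch_inf (x ^ 2 * q) (q ^ 2) * suminf (cubic_term q x)"
    by (rule tendsto_mult [OF qpoch_tendsto_mult [OF p(1)] tendsto_const]) simp
  obtain K where K: "\<And>x n. norm x \<le> 1 \<Longrightarrow> norm (cubic_term q x n) \<le> K * norm q ^ n"
    using cubic_term_bound [OF q] by blast
  have cont: "isCont (\<lambda>x. cubic_term q x n) 0" for n
  proof -
    have nz: "qpoch (q ^ 3) (q ^ 3) n \<noteq> 0"
      by (rule qpoch_nz [OF p(3) less_imp_le [OF p(3)]])
    have "qpoch (0 ^ 2 * q) (q ^ 2) n \<noteq> 0"
      by (rule qpoch_nz [OF _ less_imp_le [OF p(1)]]) simp
    with nz have "qpoch (0 ^ 2 * q) (q ^ 2) n * qpoch (q ^ 3) (q ^ 3) n \<noteq> 0" by (metis mult_eq_0_iff)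
    thus ?thesis unfolding cubic_term_def by (intro continuous_intros)
  qed
  have "(\<lambda>m. (q ^ 2) ^ m) \<longlonglongrightarrow> 0" using p by (intro LIMSEQ_power_zero) auto
  hence "(\<lambda>m. x * q ^ (2 * m)) \<longlonglongrightarrow> 0"
    unfolding power_mult by (rule tendsto_mult_right_zero)
  hence "(\<lambda>m. suminf (cubic_term q (x * q ^ (2 * m)))) \<longlonglongrightarrow> suminf (cubic_term q 0)"
    by (intro suminf_tendsto_0 [where F = "cubic_term q" and K = K and r = "norm q"] K norm_ge_zero q cont
        norm_mult_q_power_le x)
  thus "(\<lambda>m. qpoch (x ^ 2 * q) (q ^ 2) (2 * m) * suminf (cubic_term q x)) \<longlonglongrightarrow>
     qpoch_inf (- (x * q)) (q ^ 2) * qpoch_inf (- (x ^ 3 * q ^ 3)) (q ^ 6) * suminf (cubic_term q 0)"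
    unfolding cubic_sum_iterate [OF q x]
    by (rule tendsto_mult [OF tendsto_mult [OF qpoch_tendsto [OF p(1)] qpoch_tendsto [OF p(2)]]])
qed

theorem cubic_sum:
  assumes q: "norm q < 1" and x: "norm x \<le> 1"
  shows "qpoch_inf (x ^ 2 * q) (q ^ 2) * qpoch_inf (q ^ 3) (q ^ 6) * suminf (cubic_term q x)
       = qpoch_inf (- (x * q)) (q ^ 2) * qpoch_inf (- (x ^ 3 * q ^ 3)) (q ^ 6)"
proof -
  have p: "norm (q ^ 2) < 1" by (rule norm_power_less_1 [OF q]) simp
  \<comment> \<open>The factor 1 + x of \<open>(-x;q)_n\<close> kills every term with n > 0.\<close>
  have "suminf (cubic_term q (- 1)) = cubic_term q (- 1) 0"
    by (rule sums_unique [OF sums_first_term, symmetric]) (simp add: cubic_term_def qpoch_Suc_left)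
  \<comment> \<open>At x = -1 the product \<open>(q;q^2)_inf\<close> stands on both sides and
    cancels, which identifies the unknown sum at 0 as the reciprocal of
    \<open>(q^3;q^6)_inf\<close>.\<close>
  hence "qpoch_inf q (q ^ 2) = qpoch_inf q (q ^ 2) * (qpoch_inf (q ^ 3) (q ^ 6) * suminf (cubic_term q 0))"
    using cubic_sum_aux [OF q, of "- 1"] by (simp add: cubic_term_def mult_ac)
  hence "qpoch_inf (q ^ 3) (q ^ 6) * suminf (cubic_term q 0) = 1"
    using qpoch_inf_nz [OF q p] by simp
  moreover have "qpoch_inf (x ^ 2 * q) (q ^ 2) * qpoch_inf (q ^ 3) (q ^ 6) * suminf (cubic_term q x)
    = qpoch_inf (- (x * q)) (q ^ 2) * qpoch_inf (- (x ^ 3 * q ^ 3)) (q ^ 6)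
       * (qpoch_inf (q ^ 3) (q ^ 6) * suminf (cubic_term q 0))"
    using cubic_sum_aux [OF q x] by (simp add: mult_ac)
  ultimately show ?thesis by simp
qed

section \<open>A summation at a cube root of unity\<close>

text \<open>A deformation of \<open>base_term\<close> below: at x = w the last three denominators
  multiply to \<open>(q^3;q^3)_n\<close>, and the product over j becomes
  \<open>w^n (-w^2;q^2)_n\<close>. This polynomial form of \<open>x^n (-1/x;q^2)_n\<close> makes
  sense at x = 0, where the iteration ends.\<close>

definition omega_base :: "complex \<Rightarrow> complex \<Rightarrow> complex \<Rightarrow> nat \<Rightarrow> complex" where
  "omega_base w q x n = qpoch (- w) q n * (\<Prod>j<n. x + q ^ (2 * j)) * q ^ (n * (n + 1) div 2)
     / (qpoch (w ^ 2 * q) (q ^ 2) n * qpoch q q n * qpoch (w ^ 2 * q) q n * qpoch (x * q) q n)"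

text \<open>The square expands to 1 + 2 w q^n + w^2 q^(2n), so at x = w it weights T_0, T_1, T_2 by
  1, 2w, w^2.\<close>

definition omega_term :: "complex \<Rightarrow> complex \<Rightarrow> complex \<Rightarrow> nat \<Rightarrow> complex" where
  "omega_term w q x n = omega_base w q x n * (1 + w * q ^ n) ^ 2"

text \<open>The telescoping certificate for this family, playing the role of
  \<open>cubic_cert\<close>. Of the squared weight one factor is kept and the other is replaced by
  its successor, in which \<open>q ^ n\<close> is multiplied by \<open>q\<close>.\<close>

definition omega_cert :: "complex \<Rightarrow> complex \<Rightarrow> complex \<Rightarrow> nat \<Rightarrow> complex" where
  "omega_cert w q x n = (1 - x * q) * (1 - x * q ^ 2) * omega_base w q x n
     * ((1 + w * q ^ n) * q ^ n * q * x * (1 + w * q * q ^ n))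
     / ((1 - x * q * q ^ n) * (1 - x * q ^ 2 * q ^ n))"

text \<open>This holds only modulo w^2 + w + 1: already the coefficients of \<open>Q\<close> agree
  exactly when -w = 1 + w^2. Here the cube root of unity enters essentially, whereas the certificate
  of the cubic family is an identity in free variables.\<close>

lemma omega_polynomial_identity:
  fixes x q Q w :: complex
  assumes "w ^ 2 + w + 1 = 0"
  shows "(1 + w ^ 2 * x * q) * (1 + w * x * q ^ 2) * (1 + w * q * Q) * (1 + x * q ^ 2) * Q ^ 2
      - (1 + w * q * Q) * (x + Q ^ 2) * ((1 - x * q ^ 2 * Q) * (1 - x * q ^ 3 * Q))
    = (x + Q ^ 2) * q ^ 2 * Q * x * (1 + w * q ^ 2 * Q)
      - x * (1 - x * q ^ 3 * Q) * ((1 - w ^ 2 * q * Q ^ 2) * (1 - q * Q) * (1 - w ^ 2 * q * Q))"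
  using assms by algebra

lemma omega_rational_identity:
  fixes x q Q w :: complex
  assumes w: "w ^ 2 + w + 1 = 0"
    and "1 - w ^ 2 * q * Q ^ 2 \<noteq> 0" "1 - q * Q \<noteq> 0" "1 - w ^ 2 * q * Q \<noteq> 0"
    and "1 - x * q * Q \<noteq> 0" "1 - x * q ^ 2 * Q \<noteq> 0" "1 - x * q ^ 3 * Q \<noteq> 0"
  shows "(1 + w ^ 2 * x * q) * (1 + w * x * q ^ 2) * ((1 + w * q * Q) * (1 + x * q ^ 2) * Q ^ 2
           / (((1 - w ^ 2 * q * Q ^ 2) * (1 - q * Q) * (1 - w ^ 2 * q * Q))
              * ((1 - x * q * Q) * (1 - x * q ^ 2 * Q) * (1 - x * q ^ 3 * Q))))
         - (1 + w * q * Q) * (x + Q ^ 2)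
           / (((1 - w ^ 2 * q * Q ^ 2) * (1 - q * Q) * (1 - w ^ 2 * q * Q)) * (1 - x * q * Q))
       = (x + Q ^ 2) * q ^ 2 * Q * x * (1 + w * q ^ 2 * Q)
           / (((1 - w ^ 2 * q * Q ^ 2) * (1 - q * Q) * (1 - w ^ 2 * q * Q))
              * ((1 - x * q * Q) * (1 - x * q ^ 2 * Q) * (1 - x * q ^ 3 * Q)))
         - x / ((1 - x * q * Q) * (1 - x * q ^ 2 * Q))"
proof -
  define a where "a = (1 - w ^ 2 * q * Q ^ 2) * (1 - q * Q) * (1 - w ^ 2 * q * Q)"
  define x1 where "x1 = 1 - x * q * Q"
  define x2 where "x2 = 1 - x * q ^ 2 * Q"
  define x3 where "x3 = 1 - x * q ^ 3 * Q"
  have nz: "a \<noteq> 0" "x1 \<noteq> 0" "x2 \<noteq> 0" "x3 \<noteq> 0"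
    using assms by (simp_all add: a_def x1_def x2_def x3_def)
  note id = omega_polynomial_identity [OF w, of x q Q, folded x2_def x3_def, folded a_def]
  show ?thesis
    unfolding a_def [symmetric] x1_def [symmetric] x2_def [symmetric] x3_def [symmetric]
    using arg_cong [OF id, of "\<lambda>z. z / (a * x1 * x2 * x3)"] nz
    by (simp add: diff_divide_distrib mult_ac)
qed

context
  fixes w q x :: complex
  assumes w: "w ^ 2 + w + 1 = 0" and nw: "norm w = 1" and q: "norm q < 1" and x: "norm x \<le> 1"
begin

lemma one_minus_mult_power_nz: "norm c \<le> 1 \<Longrightarrow> 1 - c * q ^ Suc k \<noteq> 0"
proof -
  assume c: "norm c \<le> 1"
  have "norm (c * q ^ Suc k) \<le> 1 * norm (q ^ Suc k)"
    unfolding norm_mult using c by (intro mult_right_mono) auto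
  also have "\<dots> < 1" using norm_power_less_1 [OF q, of "Suc k"] by simp
  finally show ?thesis by (rule one_minus_nz)
qed

lemma omega_telescope_step:
  "(1 + w ^ 2 * x * q) * (1 + w * x * q ^ 2) * omega_term w q (x * q ^ 2) (Suc n)
     - (1 - x * q) * (1 - x * q ^ 2) * omega_term w q x (Suc n)
   = omega_cert w q x (Suc n) - omega_cert w q x n"
proof -
  define Q where "Q = q ^ n"
  define a where "a = (\<Prod>j<n. x + q ^ (2 * j))"
  define t where "t = q ^ (n * (n + 1) div 2)"
  define E1 where "E1 = qpoch (w ^ 2 * q) (q ^ 2) n"
  define E2 where "E2 = qpoch q q n"
  define E3 where "E3 = qpoch (w ^ 2 * q) q n"
  define E4 where "E4 = qpoch (x * q) q n"
  define W where "W = qpoch (- w) q (Suc n)"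
  define c where "c = W * a * t / (E1 * E2 * E3 * E4)"
  define d where "d = (1 - w ^ 2 * q * Q ^ 2) * (1 - q * Q) * (1 - w ^ 2 * q * Q)"
  have Q2: "(q ^ 2) ^ n = Q ^ 2" "q ^ (2 * n) = Q ^ 2"
    by (simp_all add: Q_def power_mult [symmetric] mult.commute)
  have w2: "norm (w ^ 2) \<le> 1" by (simp add: norm_power nw)
  have nz: "1 - w ^ 2 * q * Q ^ 2 \<noteq> 0" "1 - q * Q \<noteq> 0" "1 - w ^ 2 * q * Q \<noteq> 0"
    "1 - x * q * Q \<noteq> 0" "1 - x * q ^ 2 * Q \<noteq> 0" "1 - x * q ^ 3 * Q \<noteq> 0"
    using one_minus_mult_power_nz [OF w2, of "2 * n"] one_minus_mult_power_nz [of 1 n]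
      one_minus_mult_power_nz [OF w2, of n] one_minus_mult_power_nz [OF x, of n]
      one_minus_mult_power_nz [OF x, of "n + 1"] one_minus_mult_power_nz [OF x, of "n + 2"]
    by (simp_all add: Q_def power_mult [symmetric] mult_ac power_add eval_nat_numeral)
  have e: "1 - x * q \<noteq> 0" "1 - x * q ^ 2 \<noteq> 0"
    using one_minus_mult_power_nz [OF x, of 0] one_minus_mult_power_nz [OF x, of 1]
    by (simp_all add: power2_eq_square)
  have W0: "qpoch (- w) q n * (1 + w * Q) = W"
    by (simp add: W_def qpoch_Suc Q_def)
  have W1: "qpoch (- w) q (Suc n) * (1 + w * q * Q) = qpoch (- w) q (Suc (Suc n))"
    by (subst (2) qpoch_Suc) (simp add: Q_def mult_ac)
  have D1: "qpoch (w ^ 2 * q) (q ^ 2) (Suc n) * qpoch q q (Suc n) * qpoch (w ^ 2 * q) q (Suc n)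
      = E1 * E2 * E3 * d"
    by (simp add: qpoch_Suc E1_def E2_def E3_def d_def Q2 Q_def [symmetric] mult_ac)
  have E41: "qpoch (x * q) q (Suc n) = E4 * (1 - x * q * Q)"
    by (simp add: qpoch_Suc E4_def Q_def)
  \<comment> \<open>The shift of x by q^2 skips two factors in base q, so the comparison is again
    with length n + 3.\<close>
  have E4q: "qpoch (x * q ^ 2 * q) q (Suc n)
      = E4 * ((1 - x * q * Q) * (1 - x * q ^ 2 * Q) * (1 - x * q ^ 3 * Q)) / ((1 - x * q) * (1 - x * q ^ 2))"
  proof -
    have "qpoch (x * q) q (Suc (Suc (Suc n)))
        = (1 - x * q) * ((1 - x * q ^ 2) * qpoch (x * q ^ 2 * q) q (Suc n))"
      by (subst qpoch_Suc_left, subst qpoch_Suc_left) (simp add: power2_eq_square mult_ac)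
    moreover have "qpoch (x * q) q (Suc (Suc (Suc n)))
        = E4 * ((1 - x * q * Q) * (1 - x * q ^ 2 * Q) * (1 - x * q ^ 3 * Q))"
      by (simp add: qpoch_Suc E4_def Q_def eval_nat_numeral mult_ac)
    ultimately have *: "qpoch (x * q ^ 2 * q) q (Suc n) * ((1 - x * q) * (1 - x * q ^ 2))
        = E4 * ((1 - x * q * Q) * (1 - x * q ^ 2 * Q) * (1 - x * q ^ 3 * Q))"
      by (simp only: mult_ac)
    show ?thesis by (subst * [symmetric]) (use e in simp)
  qed
  have t1: "q ^ (Suc n * (Suc n + 1) div 2) = t * (q * Q)"
    unfolding triangle_power_Suc by (simp add: t_def Q_def)
  have a1: "(\<Prod>j<Suc n. x + q ^ (2 * j)) = a * (x + Q ^ 2)"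
    by (simp only: prod.lessThan_Suc a_def Q2)
  have aq: "(\<Prod>j<Suc n. x * q ^ 2 + q ^ (2 * j)) = (1 + x * q ^ 2) * Q ^ 2 * a"
  proof -
    have "(\<Prod>j<Suc n. x * q ^ 2 + q ^ (2 * j)) = (x * q ^ 2 + 1) * (\<Prod>j<n. x * q ^ 2 + q ^ (2 * Suc j))"
      by (subst prod.lessThan_Suc_shift) simp
    also have "(\<Prod>j<n. x * q ^ 2 + q ^ (2 * Suc j)) = (\<Prod>j<n. q ^ 2 * (x + q ^ (2 * j)))"
      by (intro prod.cong) (auto simp: power_add algebra_simps power2_eq_square)
    also have "\<dots> = Q ^ 2 * a"
      by (simp only: prod.distrib prod_constant card_lessThan Q2 a_def)
    finally show ?thesis by (simp add: add.commute)
  qed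
  have base0: "omega_base w q x n * (1 + w * Q) = c"
    unfolding c_def W0 [symmetric] omega_base_def
    by (simp add: a_def t_def E1_def E2_def E3_def E4_def mult_ac)
  have base1: "omega_base w q x (Suc n) = c * ((x + Q ^ 2) * (q * Q) / (d * (1 - x * q * Q)))"
    unfolding omega_base_def D1 E41 a1 t1 W_def [symmetric] c_def by (simp add: mult_ac)
  have baseq: "omega_base w q (x * q ^ 2) (Suc n)
      = (1 - x * q) * (1 - x * q ^ 2) * c * ((1 + x * q ^ 2) * Q ^ 2 * (q * Q)
          / (d * ((1 - x * q * Q) * (1 - x * q ^ 2 * Q) * (1 - x * q ^ 3 * Q))))"
    unfolding omega_base_def D1 E4q aq t1 W_def [symmetric] c_def by (simp add: mult_ac)
  have qS: "q ^ Suc n = q * Q" by (simp add: Q_def)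
  define e where "e = (1 - x * q) * (1 - x * q ^ 2) * c * ((1 + w * q * Q) * (q * Q))"
  have C0: "omega_cert w q x n = e * (x / ((1 - x * q * Q) * (1 - x * q ^ 2 * Q)))"
    unfolding omega_cert_def e_def base0 [symmetric] Q_def [symmetric] by (simp add: mult_ac)
  have C1: "omega_cert w q x (Suc n) = e * ((x + Q ^ 2) * q ^ 2 * Q * x * (1 + w * q ^ 2 * Q)
           / (d * ((1 - x * q * Q) * (1 - x * q ^ 2 * Q) * (1 - x * q ^ 3 * Q))))"
  proof -
    have "x * q * (q * Q) = x * q ^ 2 * Q" "x * q ^ 2 * (q * Q) = x * q ^ 3 * Q"
      "w * q * (q * Q) = w * q ^ 2 * Q" "w * (q * Q) = w * q * Q"
      by (simp_all add: eval_nat_numeral mult_ac)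
    thus ?thesis unfolding omega_cert_def base1 qS e_def
      by (simp add: power2_eq_square [of q] mult_ac)
  qed
  have F1: "omega_term w q x (Suc n) * ((1 - x * q) * (1 - x * q ^ 2))
      = e * ((1 + w * q * Q) * (x + Q ^ 2) / (d * (1 - x * q * Q)))"
    unfolding omega_term_def base1 qS e_def by (simp add: power2_eq_square [of "1 + _"] mult_ac)
  have Fq: "omega_term w q (x * q ^ 2) (Suc n)
      = e * ((1 + w * q * Q) * (1 + x * q ^ 2) * Q ^ 2
           / (d * ((1 - x * q * Q) * (1 - x * q ^ 2 * Q) * (1 - x * q ^ 3 * Q))))"
    unfolding omega_term_def baseq qS e_def by (simp add: power2_eq_square [of "1 + _"] mult_ac)
  have "(1 + w ^ 2 * x * q) * (1 + w * x * q ^ 2) * omega_term w q (x * q ^ 2) (Suc n)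
     - (1 - x * q) * (1 - x * q ^ 2) * omega_term w q x (Suc n)
   = e * ((1 + w ^ 2 * x * q) * (1 + w * x * q ^ 2) * ((1 + w * q * Q) * (1 + x * q ^ 2) * Q ^ 2
           / (d * ((1 - x * q * Q) * (1 - x * q ^ 2 * Q) * (1 - x * q ^ 3 * Q))))
         - (1 + w * q * Q) * (x + Q ^ 2) / (d * (1 - x * q * Q)))"
    using F1 unfolding Fq by (simp add: right_diff_distrib mult_ac)
  also have "\<dots> = omega_cert w q x (Suc n) - omega_cert w q x n"
    unfolding omega_rational_identity [OF w nz, folded d_def] C0 C1 by (simp only: right_diff_distrib)
  finally show ?thesis .
qed

lemma omega_telescope:
  "(\<Sum>k<Suc n. (1 + w ^ 2 * x * q) * (1 + w * x * q ^ 2) * omega_term w q (x * q ^ 2) k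
     - (1 - x * q) * (1 - x * q ^ 2) * omega_term w q x k) = omega_cert w q x n"
proof (induction n)
  case 0
  have "1 - x * q \<noteq> 0" "1 - x * q ^ 2 \<noteq> 0"
    using one_minus_mult_power_nz [OF x, of 0] one_minus_mult_power_nz [OF x, of 1]
    by (simp_all add: power2_eq_square)
  hence "omega_cert w q x 0 = (1 + w) * q * x * (1 + w * q)"
    by (simp add: omega_cert_def omega_base_def)
  \<comment> \<open>By w^3 = 1 the x^2 terms cancel, and the difference of the two coefficients is -
    w x q (1 + w q); then (1 + w)^2 = w and - w^2 = 1 + w give the left side.\<close>
  also have "\<dots> = (1 + w ^ 2 * x * q) * (1 + w * x * q ^ 2) * (1 + w) ^ 2 - (1 - x * q) * (1 - x * q ^ 2) * (1 + w) ^ 2"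
    using w by algebra
  finally show ?case by (simp add: omega_term_def omega_base_def)
next
  case (Suc n)
  show ?case by (subst sum.lessThan_Suc, subst Suc.IH, subst omega_telescope_step) simp
qed

end

section \<open>Bounds and evaluation of the second family\<close>

lemma omega_base_bound:
  assumes w: "norm w = 1" and q: "norm q < 1"
  obtains K where "\<And>x n. norm x \<le> 1 \<Longrightarrow> norm (omega_base w q x n) \<le> K * norm q ^ n"
proof -
  define r where "r = norm q"
  have r: "0 \<le> r" "r < 1" using q by (auto simp: r_def)
  define K where "K = exp (1 / (1 - r)) * exp (1 / (1 - r))
     * (exp (r / (1 - r) / (1 - norm (q ^ 2))) * exp (r / (1 - r) / (1 - r))
       * exp (r / (1 - r) / (1 - r)) * exp (r / (1 - r) / (1 - r)))"
  have p: "norm (q ^ 2) < 1" by (rule norm_power_less_1 [OF q]) simp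
  have w2: "norm (w ^ 2 * q) \<le> r" by (simp add: norm_mult norm_power w r_def)
  have "norm (omega_base w q x n) \<le> K * r ^ n" if x: "norm x \<le> 1" for x n
  proof -
    have x2: "norm (x * q) \<le> r"
      unfolding norm_mult r_def using x by (intro mult_left_le_one_le) auto
    have "norm (omega_base w q x n) = norm (qpoch (- w) q n) * norm (\<Prod>j<n. x + q ^ (2 * j))
        * norm (q ^ (n * (n + 1) div 2))
        * (norm (inverse (qpoch (w ^ 2 * q) (q ^ 2) n)) * norm (inverse (qpoch q q n))
            * norm (inverse (qpoch (w ^ 2 * q) q n)) * norm (inverse (qpoch (x * q) q n)))"
      by (simp only: omega_base_def norm_mult divide_inverse inverse_mult_distrib)
    also have "\<dots> \<le> exp (1 / (1 - r)) * exp (1 / (1 - r)) * r ^ n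
        * (exp (r / (1 - r) / (1 - norm (q ^ 2))) * exp (r / (1 - r) / (1 - r))
       * exp (r / (1 - r) / (1 - r)) * exp (r / (1 - r) / (1 - r)))"
    proof -
      have "norm (qpoch (- w) q n) \<le> exp (1 / (1 - r))"
        unfolding r_def using w by (intro norm_qpoch_le q) simp
      moreover have "norm (\<Prod>j<n. x + q ^ (2 * j)) \<le> exp (1 / (1 - r))"
        unfolding r_def by (rule norm_prod_add_le [OF x q]) simp
      moreover have "norm (q ^ (n * (n + 1) div 2)) \<le> r ^ n"
        unfolding r_def by (rule norm_triangle_power_le [OF q])
      moreover have "norm (inverse (qpoch (w ^ 2 * q) (q ^ 2) n)) \<le> exp (r / (1 - r) / (1 - norm (q ^ 2)))"
        by (rule norm_inverse_qpoch_le [OF w2 r(2) p])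
      moreover have "norm (inverse (qpoch c q n)) \<le> exp (r / (1 - r) / (1 - r))" if "norm c \<le> r" for c
        using norm_inverse_qpoch_le [OF that r(2) q] by (simp only: r_def)
      note this [OF eq_refl [OF r_def [symmetric]]] this [OF w2] this [OF x2]
      ultimately show ?thesis
        by (intro mult_mono' mult_nonneg_nonneg norm_ge_zero)
    qed
    finally show ?thesis unfolding K_def by (simp only: mult_ac)
  qed
  thus thesis using that unfolding r_def by blast
qed

lemma omega_term_bound:
  assumes w: "norm w = 1" and q: "norm q < 1"
  obtains K where "\<And>x n. norm x \<le> 1 \<Longrightarrow> norm (omega_term w q x n) \<le> K * norm q ^ n"
proof -
  obtain K where K: "\<And>x n. norm x \<le> 1 \<Longrightarrow> norm (omega_base w q x n) \<le> K * norm q ^ n"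
    using omega_base_bound [OF w q] by blast
  have "norm (omega_term w q x n) \<le> (K * 4) * norm q ^ n" if x: "norm x \<le> 1" for x n
  proof -
    have "norm (1 + w * q ^ n) \<le> 1 + norm (w * q ^ n)"
      using norm_triangle_ineq [of 1 "w * q ^ n"] by simp
    also have "\<dots> \<le> 2" using w q by (simp add: norm_mult norm_power power_le_one)
    finally have "norm (1 + w * q ^ n) ^ 2 \<le> 2 ^ 2" by (intro power_mono) auto
    hence "norm (omega_term w q x n) \<le> (K * norm q ^ n) * 4"
      unfolding omega_term_def norm_mult norm_power
      using K [OF x, of n] order_trans [OF norm_ge_zero K [OF x, of n]] by (intro mult_mono) auto
    thus ?thesis by (simp add: mult_ac)
  qed
  thus thesis using that by blast
qed

context
  fixes w q :: complex
  assumes w: "w ^ 2 + w + 1 = 0" and nw: "norm w = 1" and q: "norm q < 1"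
begin

lemma summable_omega_term:
  assumes x: "norm x \<le> 1"
  shows "summable (omega_term w q x)"
proof -
  obtain K where K: "\<And>x n. norm x \<le> 1 \<Longrightarrow> norm (omega_term w q x n) \<le> K * norm q ^ n"
    using omega_term_bound [OF nw q] by blast
  have "summable (\<lambda>n. K * norm q ^ n)"
    using q by (intro summable_mult summable_geometric) simp
  thus ?thesis by (rule summable_comparison_test') (rule K [OF x])
qed

lemma omega_cert_tendsto_0:
  assumes x: "norm x \<le> 1"
  shows "omega_cert w q x \<longlonglongrightarrow> 0"
proof -
  obtain K where K: "\<And>x n. norm x \<le> 1 \<Longrightarrow> norm (omega_base w q x n) \<le> K * norm q ^ n"
    using omega_base_bound [OF nw q] by blast
  have "summable (\<lambda>n. K * norm q ^ n)"
    using q by (intro summable_mult summable_geometric) simp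
  hence "summable (omega_base w q x)" by (rule summable_comparison_test') (rule K [OF x])
  hence 0: "omega_base w q x \<longlonglongrightarrow> 0" by (rule summable_LIMSEQ_zero)
  have 1: "(\<lambda>n. q ^ n) \<longlonglongrightarrow> 0" using q by (rule LIMSEQ_power_zero)
  have "(\<lambda>n. c * f n * ((1 + w * u n) * u n * q * x * (1 + w * q * u n))
            / ((1 - x * q * u n) * (1 - x * q ^ 2 * u n))) \<longlonglongrightarrow> 0"
    if "f \<longlonglongrightarrow> 0" "u \<longlonglongrightarrow> 0" for c :: complex and f u :: "nat \<Rightarrow> complex"
    by (rule tendsto_eq_intros that refl | simp)+
  from this [OF 0 1] show ?thesis unfolding omega_cert_def .
qed

lemma omega_sum_step:
  assumes x: "norm x \<le> 1"
  shows "(1 - x * q) * (1 - x * q ^ 2) * suminf (omega_term w q x)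
       = (1 + w ^ 2 * x * q) * (1 + w * x * q ^ 2) * suminf (omega_term w q (x * q ^ 2))"
proof -
  define c where "c = (\<lambda>k. (1 + w ^ 2 * x * q) * (1 + w * x * q ^ 2) * omega_term w q (x * q ^ 2) k
     - (1 - x * q) * (1 - x * q ^ 2) * omega_term w q x k)"
  note sum = summable_sums [OF summable_omega_term]
  have "c sums ((1 + w ^ 2 * x * q) * (1 + w * x * q ^ 2) * suminf (omega_term w q (x * q ^ 2))
     - (1 - x * q) * (1 - x * q ^ 2) * suminf (omega_term w q x))"
    unfolding c_def
    by (rule sums_diff [OF sums_mult [OF sum [OF norm_mult_q_power_le [OF q x]]] sums_mult [OF sum [OF x]]])
  moreover have "(\<lambda>n. sum c {..<Suc n}) \<longlonglongrightarrow> 0"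
    using omega_cert_tendsto_0 [OF x] unfolding c_def omega_telescope [OF w nw q x] .
  hence "c sums 0"
    unfolding sums_def by (simp only: filterlim_sequentially_Suc [where f = "\<lambda>n. sum c {..<n}"])
  ultimately show ?thesis by (metis sums_unique2 eq_iff_diff_eq_0)
qed

lemma omega_sum_iterate:
  assumes x: "norm x \<le> 1"
  shows "qpoch (x * q) q (2 * m) * suminf (omega_term w q x)
       = qpoch (- (w ^ 2 * x * q)) (q ^ 2) m * qpoch (- (w * x * q ^ 2)) (q ^ 2) m
           * suminf (omega_term w q (x * q ^ (2 * m)))"
proof (induction m)
  case (Suc m)
  define z where "z = q ^ (2 * m)"
  define y where "y = x * z"
  have y: "norm y \<le> 1" unfolding y_def z_def by (rule norm_mult_q_power_le [OF q x])
  have z: "(q ^ 2) ^ m = z" by (simp add: z_def power_mult [symmetric])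
  have "qpoch (x * q) q (2 * Suc m) = qpoch (x * q) q (2 * m) * (1 - x * q * z) * (1 - x * q * (q * z))"
    by (simp only: mult_Suc_right add_2_eq_Suc qpoch_Suc power_Suc z_def)
  also have "\<dots> = qpoch (x * q) q (2 * m) * ((1 - y * q) * (1 - y * q ^ 2))"
    unfolding y_def by algebra
  finally have "qpoch (x * q) q (2 * Suc m) * suminf (omega_term w q x)
      = (1 - y * q) * (1 - y * q ^ 2) * (qpoch (x * q) q (2 * m) * suminf (omega_term w q x))"
    by (simp only: mult_ac)
  also have "\<dots> = qpoch (- (w ^ 2 * x * q)) (q ^ 2) m * qpoch (- (w * x * q ^ 2)) (q ^ 2) m
         * ((1 - y * q) * (1 - y * q ^ 2) * suminf (omega_term w q y))"
    unfolding Suc.IH y_def z_def by (simp only: mult_ac)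
  also have "(1 - y * q) * (1 - y * q ^ 2) * suminf (omega_term w q y)
      = (1 + w ^ 2 * y * q) * (1 + w * y * q ^ 2) * suminf (omega_term w q (y * q ^ 2))"
    by (rule omega_sum_step [OF y])
  also have "y * q ^ 2 = x * q ^ (2 * Suc m)" by (simp add: y_def z_def power2_eq_square)
  also have "qpoch (- (w ^ 2 * x * q)) (q ^ 2) m * qpoch (- (w * x * q ^ 2)) (q ^ 2) m
        * ((1 + w ^ 2 * y * q) * (1 + w * y * q ^ 2) * suminf (omega_term w q (x * q ^ (2 * Suc m))))
      = (qpoch (- (w ^ 2 * x * q)) (q ^ 2) m * (1 - - (w ^ 2 * x * q) * z))
        * (qpoch (- (w * x * q ^ 2)) (q ^ 2) m * (1 - - (w * x * q ^ 2) * z))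
        * suminf (omega_term w q (x * q ^ (2 * Suc m)))"
    unfolding y_def by algebra
  finally show ?case by (simp only: qpoch_Suc z)
qed simp

lemma omega_sum_aux:
  assumes x: "norm x \<le> 1"
  shows "qpoch_inf (x * q) q * suminf (omega_term w q x)
       = qpoch_inf (- (w ^ 2 * x * q)) (q ^ 2) * qpoch_inf (- (w * x * q ^ 2)) (q ^ 2)
           * suminf (omega_term w q 0)"
proof (rule LIMSEQ_unique)
  have p: "norm (q ^ 2) < 1" by (rule norm_power_less_1 [OF q]) simp
  show "(\<lambda>m. qpoch (x * q) q (2 * m) * suminf (omega_term w q x))
     \<longlonglongrightarrow> qpoch_inf (x * q) q * suminf (omega_term w q x)"
    by (rule tendsto_mult [OF qpoch_tendsto_mult [OF q] tendsto_const]) simp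
  obtain K where K: "\<And>x n. norm x \<le> 1 \<Longrightarrow> norm (omega_term w q x n) \<le> K * norm q ^ n"
    using omega_term_bound [OF nw q] by blast
  have w2: "norm (w ^ 2 * q) < 1" using q by (simp add: norm_mult norm_power nw)
  have "qpoch (w ^ 2 * q) (q ^ 2) n \<noteq> 0" "qpoch q q n \<noteq> 0" "qpoch (w ^ 2 * q) q n \<noteq> 0"
    "qpoch 0 q n \<noteq> 0" for n
    using p q w2 by (intro qpoch_nz; simp)+
  hence cont: "isCont (\<lambda>x. omega_term w q x n) 0" for n
    unfolding omega_term_def omega_base_def by (intro continuous_intros) simp_all
  have "(\<lambda>m. (q ^ 2) ^ m) \<longlonglongrightarrow> 0" using p by (intro LIMSEQ_power_zero) auto
  hence "(\<lambda>m. x * q ^ (2 * m)) \<longlonglongrightarrow> 0"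
    unfolding power_mult by (rule tendsto_mult_right_zero)
  hence "(\<lambda>m. suminf (omega_term w q (x * q ^ (2 * m)))) \<longlonglongrightarrow> suminf (omega_term w q 0)"
    by (intro suminf_tendsto_0 [where F = "omega_term w q" and K = K and r = "norm q"] K norm_ge_zero q cont
        norm_mult_q_power_le x)
  thus "(\<lambda>m. qpoch (x * q) q (2 * m) * suminf (omega_term w q x)) \<longlonglongrightarrow>
     qpoch_inf (- (w ^ 2 * x * q)) (q ^ 2) * qpoch_inf (- (w * x * q ^ 2)) (q ^ 2)
           * suminf (omega_term w q 0)"
    unfolding omega_sum_iterate [OF x]
    by (rule tendsto_mult [OF tendsto_mult [OF qpoch_tendsto [OF p] qpoch_tendsto [OF p]]])
qed

theorem omega_sum:
  assumes x: "norm x \<le> 1"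
  shows "qpoch_inf (w ^ 2 * q) (q ^ 2) * qpoch_inf (w * q ^ 2) (q ^ 2) * qpoch_inf (x * q) q
           * suminf (omega_term w q x)
       = w * qpoch_inf (- q) q * qpoch_inf (- (w ^ 2 * x * q)) (q ^ 2) * qpoch_inf (- (w * x * q ^ 2)) (q ^ 2)"
proof -
  have "suminf (omega_term w q (- 1)) = omega_term w q (- 1) 0"
  proof (rule sums_unique [OF sums_first_term, symmetric])
    fix n
    have "(\<Prod>j<Suc n. - 1 + q ^ (2 * j)) = 0"
      by (subst prod.lessThan_Suc_shift) simp
    thus "omega_term w q (- 1) (Suc n) = 0"
      unfolding omega_term_def omega_base_def by (simp only: mult_zero_left mult_zero_right div_0)
  qed
  \<comment> \<open>The weight does not disappear at n = 0: it is (1 + w)^2 = w, the origin of the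
    factor \<open>w\<close> in the evaluation.\<close>
  also have "\<dots> = w" using w by (simp add: omega_term_def omega_base_def) algebra
  finally have "qpoch_inf (- q) q * w = qpoch_inf (w ^ 2 * q) (q ^ 2) * qpoch_inf (w * q ^ 2) (q ^ 2)
           * suminf (omega_term w q 0)"
    using omega_sum_aux [of "- 1"] by simp
  moreover have "qpoch_inf (w ^ 2 * q) (q ^ 2) * qpoch_inf (w * q ^ 2) (q ^ 2) * qpoch_inf (x * q) q
           * suminf (omega_term w q x)
     = qpoch_inf (- (w ^ 2 * x * q)) (q ^ 2) * qpoch_inf (- (w * x * q ^ 2)) (q ^ 2)
       * (qpoch_inf (w ^ 2 * q) (q ^ 2) * qpoch_inf (w * q ^ 2) (q ^ 2) * suminf (omega_term w q 0))"
    using omega_sum_aux [OF x] by (simp add: mult_ac)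
  ultimately show ?thesis by (simp add: mult_ac)
qed

end

section \<open>Theta series\<close>

text \<open>One half of the theta series. Its part of negative index is the same series at q/z,
  because the exponent n(n-1)/2 at -m is m(m-1)/2 + m. The full bilateral series is therefore
  \<open>ptheta z q + ptheta y q - 1\<close> with y z = q, where the 1 corrects for counting index 0
  twice.\<close>

definition ptheta_term :: "complex \<Rightarrow> complex \<Rightarrow> nat \<Rightarrow> complex" where
  "ptheta_term z q n = (- 1) ^ n * q ^ (n * (n - 1) div 2) * z ^ n"

definition ptheta :: "complex \<Rightarrow> complex \<Rightarrow> complex" where
  "ptheta z q = suminf (ptheta_term z q)"

lemma triangle_pred_Suc: "Suc n * (Suc n - 1) div 2 = n * (n - 1) div 2 + n"
  by (cases n) auto

lemma ptheta_term_Suc: "ptheta_term z q (Suc n) = - z * q ^ n * ptheta_term z q n"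
  unfolding ptheta_term_def triangle_pred_Suc power_add power_Suc by (simp only: mult_ac) simp

lemma ptheta_term_0 [simp]: "ptheta_term z q 0 = 1"
  by (simp add: ptheta_term_def)

lemma summable_norm_ptheta_term:
  assumes "norm q < 1"
  shows "summable (\<lambda>n. norm (ptheta_term z q n))"
proof -
  have "(\<lambda>n. norm z * norm q ^ n) \<longlonglongrightarrow> norm z * 0"
    using assms by (intro tendsto_mult tendsto_const LIMSEQ_power_zero) simp
  hence "eventually (\<lambda>n. norm z * norm q ^ n < 1 / 2) sequentially"
    by (rule order_tendstoD) simp
  then obtain N where N: "\<And>n. n \<ge> N \<Longrightarrow> norm z * norm q ^ n < 1 / 2"
    unfolding eventually_sequentially by blast
  show ?thesis
  proof (rule summable_ratio_test)
    show "norm (norm (ptheta_term z q (Suc n))) \<le> 1 / 2 * norm (norm (ptheta_term z q n))" if "n \<ge> N" for n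
      using mult_right_mono [OF less_imp_le [OF N [OF that]], of "norm (ptheta_term z q n)"]
      by (simp add: ptheta_term_Suc norm_mult norm_power)
  qed simp
qed

lemma summable_ptheta_term: "norm q < 1 \<Longrightarrow> summable (ptheta_term z q)"
  by (rule summable_norm_cancel [OF summable_norm_ptheta_term])

lemma ptheta_shift:
  assumes "norm q < 1"
  shows "ptheta z q - 1 = - z * ptheta (z * q) q"
proof -
  have "ptheta_term z q (Suc n) = - z * ptheta_term (z * q) q n" for n
    unfolding ptheta_term_Suc by (simp add: ptheta_term_def power_mult_distrib)
  hence "(\<Sum>n. ptheta_term z q (Suc n)) = - z * ptheta (z * q) q"
    unfolding ptheta_def by (simp only: suminf_mult [OF summable_ptheta_term [OF assms]])
  thus ?thesis
    using suminf_split_head [OF summable_ptheta_term [OF assms, of z]] by (simp add: ptheta_def)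
qed

text \<open>The triangular exponent is 4 n(n-1)/2 + n at 2n and 4 n(n-1)/2 + 3n at 2n + 1, so both
  subsequences are theta terms in base q^4. The minus signs in the arguments cancel the alternating
  sign, which neither subsequence has.\<close>

lemma ptheta_even_odd:
  assumes q: "norm q < 1"
  shows "ptheta z q = ptheta (- (q * z ^ 2)) (q ^ 4) - z * ptheta (- (q ^ 3 * z ^ 2)) (q ^ 4)"
proof -
  have q4: "norm (q ^ 4) < 1" by (rule norm_power_less_1 [OF q]) simp
  have tri: "n * (n - 1) = 2 * (n * (n - 1) div 2)" for n :: nat
    by (cases n) auto
  have 1: "2 * n * (2 * n - 1) div 2 = 4 * (n * (n - 1) div 2) + n" for n :: nat
  proof -
    have "2 * n * (2 * n - 1) div 2 = n * (2 * n - 1)" by simp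
    also have "\<dots> = 2 * (n * (n - 1)) + n" by (cases n) (auto simp: algebra_simps)
    finally show ?thesis using tri [of n] by linarith
  qed
  have even: "ptheta_term z q (n * 2) = ptheta_term (- (q * z ^ 2)) (q ^ 4) n" for n
  proof -
    have m: "(- 1 :: complex) ^ n * (- 1) ^ n = 1" by (simp flip: power_mult_distrib)
    have "(- (q * z ^ 2)) ^ n = (- 1) ^ n * (q ^ n * z ^ (2 * n))"
      by (subst power_minus) (simp only: power_mult_distrib power_mult)
    hence "ptheta_term (- (q * z ^ 2)) (q ^ 4) n
        = ((- 1) ^ n * (- 1) ^ n) * (q ^ (4 * (n * (n - 1) div 2)) * q ^ n * z ^ (2 * n))"
      unfolding ptheta_term_def by (simp only: power_mult mult_ac)
    also have "\<dots> = ptheta_term z q (n * 2)"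
      unfolding ptheta_term_def mult.commute [of n 2] 1 m power_add by simp
    finally show ?thesis by simp
  qed
  have odd: "ptheta_term z q (Suc (n * 2)) = - z * ptheta_term (- (q ^ 3 * z ^ 2)) (q ^ 4) n" for n
  proof -
    have "ptheta_term z q (Suc (n * 2)) = - z * q ^ (2 * n) * ptheta_term (- (q * z ^ 2)) (q ^ 4) n"
      unfolding ptheta_term_Suc even by (simp add: mult.commute)
    also have "\<dots> = - z * ptheta_term (- (q ^ 3 * z ^ 2)) (q ^ 4) n"
    proof -
      have "(- (q ^ 3 * z ^ 2)) ^ n = q ^ (2 * n) * (- (q * z ^ 2)) ^ n"
        unfolding power_mult power_mult_distrib [symmetric]
        by (rule arg_cong [where f = "\<lambda>u. u ^ n"]) algebra
      thus ?thesis by (simp add: ptheta_term_def)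
    qed
    finally show ?thesis .
  qed
  have "(\<lambda>n. sum (ptheta_term z q) {n * 2..<n * 2 + 2}) sums ptheta z q"
    unfolding ptheta_def by (rule sums_group [OF summable_sums [OF summable_ptheta_term [OF q]]]) simp
  moreover have "sum (ptheta_term z q) {n * 2..<n * 2 + 2}
      = ptheta_term (- (q * z ^ 2)) (q ^ 4) n + - z * ptheta_term (- (q ^ 3 * z ^ 2)) (q ^ 4) n" for n
    unfolding even [symmetric] odd [symmetric] by (simp add: atLeastLessThanSuc)
  ultimately have "(\<lambda>n. ptheta_term (- (q * z ^ 2)) (q ^ 4) n + - z * ptheta_term (- (q ^ 3 * z ^ 2)) (q ^ 4) n)
      sums ptheta z q" by simp
  moreover have "(\<lambda>n. ptheta_term (- (q * z ^ 2)) (q ^ 4) n + - z * ptheta_term (- (q ^ 3 * z ^ 2)) (q ^ 4) n)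
      sums (ptheta (- (q * z ^ 2)) (q ^ 4) + - z * ptheta (- (q ^ 3 * z ^ 2)) (q ^ 4))"
    unfolding ptheta_def
    by (rule sums_add [OF summable_sums [OF summable_ptheta_term [OF q4]]
          sums_mult [OF summable_sums [OF summable_ptheta_term [OF q4]]]])
  ultimately show ?thesis using sums_unique2 by fastforce
qed

text \<open>The Gaussian binomial coefficient of 2N over N + n in base \<open>q\<close>. The value 0
  for n > N lets recurrences run over all n and sums run past N.\<close>

definition jtp_coeff :: "complex \<Rightarrow> nat \<Rightarrow> nat \<Rightarrow> complex" where
  "jtp_coeff q N n = (if n \<le> N then qpoch q q (2 * N) / (qpoch q q (N - n) * qpoch q q (N + n)) else 0)"

definition jtp_term :: "complex \<Rightarrow> nat \<Rightarrow> nat \<Rightarrow> complex" where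
  "jtp_term q N n = (- 1) ^ n * q ^ (n * (n - 1) div 2) * jtp_coeff q N n"

text \<open>This compares coefficients of z^(n+1) when the finite product is multiplied by (1 - z
  q^N)(1 - y q^N) = 1 + q^(2N+1) - q^N (z + y). The index n contributes through z z^n, and the index
  n + 2 through y z^(n+2) = q z^(n+1), hence the extra power of \<open>q\<close>.\<close>

lemma jtp_term_rec:
  assumes q: "norm q < 1"
  shows "jtp_term q (Suc N) (Suc n) = (1 + q ^ (2 * N + 1)) * jtp_term q N (Suc n)
     - q ^ N * jtp_term q N n - q ^ (N + 1) * jtp_term q N (Suc (Suc n))"
proof -
  have nzq: "1 - q * q ^ k \<noteq> 0" for k
    using one_minus_nz [OF norm_power_less_1 [OF q, of "Suc k"]] by simp
  have nz: "qpoch q q k \<noteq> 0" for k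
    using q by (intro qpoch_nz) auto
  define s where "s = (- 1) ^ n * q ^ (n * (n - 1) div 2)"
  define T where "T = q ^ n"
  have s1: "(- 1) ^ Suc n * q ^ (Suc n * (Suc n - 1) div 2) = - s * T"
    unfolding triangle_pred_Suc power_add by (simp add: s_def T_def)
  have s2: "(- 1) ^ Suc (Suc n) * q ^ (Suc (Suc n) * (Suc (Suc n) - 1) div 2) = s * T * (q * T)"
    unfolding triangle_pred_Suc power_add by (simp add: s_def T_def)
  \<comment> \<open>Near the edge some coefficients are 0 by convention and not by the quotient
    formula, so these cases are separate. In the last case all indices are in range and N - n - 2 is
    the natural number m.\<close>
  consider "n > N" | "n = N" | "N = Suc n" | m where "N = m + n + 2"
    by (metis less_imp_add_positive add.commute add_2_eq_Suc' not_less_eq linorder_neqE_nat less_iff_Suc_add add_Suc)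
  thus ?thesis
  proof cases
    case 1
    thus ?thesis by (simp add: jtp_term_def jtp_coeff_def)
  next
    case 2
    have e1: "jtp_term q (Suc N) (Suc n) = - s * T"
      unfolding jtp_term_def s1 using 2 nz by (simp add: jtp_coeff_def mult_2)
    have e2: "jtp_term q N n = s"
      unfolding jtp_term_def s_def [symmetric] using 2 nz by (simp add: jtp_coeff_def mult_2)
    have e3: "jtp_term q N (Suc n) = 0" "jtp_term q N (Suc (Suc n)) = 0"
      using 2 by (simp_all add: jtp_term_def jtp_coeff_def)
    show ?thesis unfolding e1 e2 e3 using 2 by (simp add: T_def)
  next
    case 3
    define C where "C = qpoch q q (2 * n + 1)"
    have C: "C \<noteq> 0" by (simp add: C_def nz)
    have q1: "1 - q \<noteq> 0" using nzq [of 0] by simp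
    have T2: "q ^ (2 * n) = T ^ 2" by (simp add: T_def power_mult [symmetric] mult.commute)
    have Sucs: "2 * n + 1 = Suc (2 * n)" "2 * n + 2 = Suc (Suc (2 * n))"
      "2 * n + 3 = Suc (Suc (Suc (2 * n)))" "2 * n + 4 = Suc (Suc (Suc (Suc (2 * n))))" by simp_all
    have C2: "qpoch q q (2 * n + 2) = C * (1 - q * (q * T ^ 2))"
      unfolding C_def Sucs by (simp only: qpoch_Suc power_Suc T2)
    have C3: "qpoch q q (2 * n + 3) = C * (1 - q * (q * T ^ 2)) * (1 - q * (q * (q * T ^ 2)))"
      unfolding C_def Sucs by (simp only: qpoch_Suc power_Suc T2)
    have C4: "qpoch q q (2 * n + 4) = C * (1 - q * (q * T ^ 2)) * (1 - q * (q * (q * T ^ 2))) * (1 - q * (q * (q * (q * T ^ 2))))"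
      unfolding C_def Sucs by (simp only: qpoch_Suc power_Suc T2)
    have n2: "1 - q * (q * T ^ 2) \<noteq> 0" and n3: "1 - q * (q * (q * T ^ 2)) \<noteq> 0"
      using nzq [of "Suc (2 * n)"] nzq [of "Suc (Suc (2 * n))"] by (simp_all only: power_Suc T2 not_False_eq_True)
    have "jtp_coeff q (Suc N) (Suc n) = qpoch q q (2 * n + 4) / (qpoch q q 1 * qpoch q q (2 * n + 3))"
      using 3 by (simp add: jtp_coeff_def eval_nat_numeral)
    also have "\<dots> = (1 - q * (q * (q * (q * T ^ 2)))) / (1 - q)"
      unfolding C4 C3 using C n2 n3 by (simp add: qpoch_Suc)
    finally have e1: "jtp_term q (Suc N) (Suc n) = - s * T * ((1 - q * (q * (q * (q * T ^ 2)))) / (1 - q))"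
      unfolding jtp_term_def s1 by simp
    have e2: "jtp_term q N (Suc n) = - s * T"
      unfolding jtp_term_def s1 using 3 nz by (simp add: jtp_coeff_def mult_2)
    have "jtp_coeff q N n = qpoch q q (2 * n + 2) / (qpoch q q 1 * qpoch q q (2 * n + 1))"
      using 3 by (simp add: jtp_coeff_def eval_nat_numeral)
    also have "\<dots> = (1 - q * (q * T ^ 2)) / (1 - q)"
      unfolding C2 C_def [symmetric] using C by (simp add: qpoch_Suc)
    finally have e3: "jtp_term q N n = s * ((1 - q * (q * T ^ 2)) / (1 - q))"
      unfolding jtp_term_def s_def by simp
    have e4: "jtp_term q N (Suc (Suc n)) = 0"
      using 3 by (simp add: jtp_term_def jtp_coeff_def)
    have "2 * N + 1 = 2 * n + 3" using 3 by simp
    hence "q ^ (2 * N + 1) = q ^ (2 * n + 3)" by (simp only:)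
    also have "\<dots> = q ^ 3 * T ^ 2" unfolding power_add T2 by (rule mult.commute)
    finally have "q ^ (2 * N + 1) = q ^ 3 * T ^ 2" .
    moreover have "q ^ N = q * T" using 3 by (simp add: T_def)
    ultimately have qN: "q ^ N = q * T" "q ^ (2 * N + 1) = q ^ 3 * T ^ 2" by simp_all
    define D where "D = s / (1 - q)"
    have sD: "s = D * (1 - q)" using q1 by (simp add: D_def)
    have "jtp_term q (Suc N) (Suc n) = - D * T * (1 - q * (q * (q * (q * T ^ 2))))"
      unfolding e1 D_def by simp
    also have "\<dots> = (1 + q ^ 3 * T ^ 2) * (- (D * (1 - q)) * T) - q * T * (D * (1 - q * (q * T ^ 2)))"
      by algebra
    also have "D * (1 - q * (q * T ^ 2)) = jtp_term q N n" unfolding e3 D_def by simp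
    finally show ?thesis unfolding e2 e4 qN sD by simp
  next
    case (4 m)
    define A where "A = qpoch q q m"
    define B where "B = qpoch q q (N + n)"
    define C where "C = qpoch q q (2 * N)"
    define R where "R = q ^ m"
    have qN: "q ^ N = q ^ 2 * R * T"
      using 4 by (simp add: R_def T_def power_add power2_eq_square mult_ac)
    define X where "X = q ^ N"
    have X: "X = q ^ 2 * R * T" unfolding X_def by (rule qN)
    have q2N: "q ^ (2 * N) = X ^ 2" "q ^ (N + n) = X * T"
      by (simp_all add: X_def T_def power_mult [symmetric] power_add mult.commute)
    have ABC: "A \<noteq> 0" "B \<noteq> 0" "C \<noteq> 0" by (simp_all add: A_def B_def C_def nz)
    have A1: "qpoch q q (Suc m) = A * (1 - q * R)"
      by (simp add: qpoch_Suc A_def R_def)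
    have A2: "qpoch q q (Suc (Suc m)) = A * (1 - q * R) * (1 - q * (q * R))"
      by (simp add: qpoch_Suc A_def R_def)
    have B1: "qpoch q q (Suc (N + n)) = B * (1 - q * (X * T))"
      by (simp only: qpoch_Suc B_def q2N)
    have B2: "qpoch q q (Suc (Suc (N + n))) = B * (1 - q * (X * T)) * (1 - q * (q * (X * T)))"
      by (simp only: qpoch_Suc B_def q2N power_Suc)
    have C2: "qpoch q q (Suc (Suc (2 * N))) = C * (1 - q * X ^ 2) * (1 - q * (q * X ^ 2))"
      by (simp only: qpoch_Suc C_def q2N power_Suc)
    have n: "1 - q * R \<noteq> 0" "1 - q * (q * R) \<noteq> 0" "1 - q * (X * T) \<noteq> 0" "1 - q * (q * (X * T)) \<noteq> 0"
      using nzq [of m] nzq [of "Suc m"] nzq [of "N + n"] nzq [of "Suc (N + n)"]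
      by (simp_all only: R_def q2N power_Suc not_False_eq_True)
    define a1 where "a1 = 1 - q * R"
    define a2 where "a2 = 1 - q * (q * R)"
    define b1 where "b1 = 1 - q * (X * T)"
    define b2 where "b2 = 1 - q * (q * (X * T))"
    define D where "D = s * C / (A * a1 * a2 * (B * b1 * b2))"
    note nn = n [folded a1_def a2_def b1_def b2_def]
    have "jtp_coeff q (Suc N) (Suc n) = C * (1 - q * X ^ 2) * (1 - q * (q * X ^ 2)) / (A * a1 * a2 * (B * b1 * b2))"
      unfolding a1_def a2_def b1_def b2_def A2 [symmetric] B2 [symmetric] C2 [symmetric]
      using 4 by (simp add: jtp_coeff_def)
    hence e1: "jtp_term q (Suc N) (Suc n) = D * (- T * (1 - q * X ^ 2) * (1 - q * (q * X ^ 2)))"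
      unfolding jtp_term_def s1 D_def by simp
    have "jtp_coeff q N (Suc n) = C / (A * a1 * (B * b1))"
      unfolding a1_def b1_def A1 [symmetric] B1 [symmetric] C_def
      using 4 by (simp add: jtp_coeff_def)
    hence e2: "jtp_term q N (Suc n) = D * (- T * a2 * b2)"
      unfolding jtp_term_def s1 D_def using nn by (simp add: mult_ac)
    have "jtp_coeff q N n = C / (A * a1 * a2 * B)"
      unfolding a1_def a2_def A2 [symmetric] B_def C_def
      using 4 by (simp add: jtp_coeff_def)
    hence e3: "jtp_term q N n = D * (b1 * b2)"
      unfolding jtp_term_def s_def [symmetric] D_def using nn by (simp add: mult_ac)
    have "jtp_coeff q N (Suc (Suc n)) = C / (A * (B * b1 * b2))"
      unfolding b1_def b2_def A_def B2 [symmetric] C_def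
      using 4 by (simp add: jtp_coeff_def)
    hence e4: "jtp_term q N (Suc (Suc n)) = D * (T * (q * T) * a1 * a2)"
      unfolding jtp_term_def s2 D_def using nn by (simp add: mult_ac)
    have "- T * (1 - q * X ^ 2) * (1 - q * (q * X ^ 2))
        = (1 + X ^ 2 * q) * (- T * a2 * b2) - X * (b1 * b2) - X * q * (T * (q * T) * a1 * a2)"
      unfolding a1_def a2_def b1_def b2_def X by algebra
    hence "D * (- T * (1 - q * X ^ 2) * (1 - q * (q * X ^ 2)))
        = (1 + X ^ 2 * q) * (D * (- T * a2 * b2)) - X * (D * (b1 * b2)) - X * q * (D * (T * (q * T) * a1 * a2))"
      by algebra
    thus ?thesis unfolding e1 e2 e3 e4 power_add q2N X_def [symmetric] by simp
  qed
qed

text \<open>The constant coefficient receives the index 1 twice, from y z and from z y, which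
  explains the 2.\<close>

lemma jtp_term_rec_0:
  assumes q: "norm q < 1"
  shows "jtp_term q (Suc N) 0 = (1 + q ^ (2 * N + 1)) * jtp_term q N 0 - 2 * q ^ (N + 1) * jtp_term q N 1"
proof -
  have nzq: "1 - q * q ^ k \<noteq> 0" for k
    using one_minus_nz [OF norm_power_less_1 [OF q, of "Suc k"]] by simp
  have nz: "qpoch q q k \<noteq> 0" for k
    using q by (intro qpoch_nz) auto
  show ?thesis
  proof (cases N)
    case 0
    have "(1 - q) * (1 - q * q) / ((1 - q) * (1 - q)) = 1 + q"
    proof -
      have "(1 - q) * (1 - q * q) = (1 + q) * ((1 - q) * (1 - q))" by algebra
      thus ?thesis using nzq [of 0] by simp
    qed
    thus ?thesis using 0 by (simp add: jtp_term_def jtp_coeff_def qpoch_Suc eval_nat_numeral)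
  next
    case (Suc m)
    define A where "A = qpoch q q m"
    define C where "C = qpoch q q (2 * N)"
    define X where "X = q ^ m"
    have "q ^ (2 * N) = (q ^ N) ^ 2" by (simp add: power_mult [symmetric] mult.commute)
    moreover have "q ^ N = q * X" using Suc by (simp add: X_def)
    ultimately have q2N: "q ^ (2 * N) = q ^ 2 * X ^ 2" "q ^ N = q * X"
      by (simp_all add: power_mult_distrib)
    define a1 where "a1 = 1 - q * X"
    define a2 where "a2 = 1 - q * (q * X)"
    have ABC: "A \<noteq> 0" "C \<noteq> 0" by (simp_all add: A_def C_def nz)
    have nn: "a1 \<noteq> 0" "a2 \<noteq> 0"
      using nzq [of m] nzq [of "Suc m"] by (simp_all only: a1_def a2_def X_def power_Suc not_False_eq_True)
    have A1: "qpoch q q N = A * a1"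
      using Suc by (simp add: qpoch_Suc A_def X_def a1_def)
    have A2: "qpoch q q (Suc N) = A * a1 * a2"
      using Suc by (simp add: qpoch_Suc A_def X_def a1_def a2_def)
    have C2: "qpoch q q (2 * Suc N) = C * (1 - q * (q ^ 2 * X ^ 2)) * (1 - q * (q * (q ^ 2 * X ^ 2)))"
      by (simp only: mult_Suc_right add_2_eq_Suc qpoch_Suc power_Suc q2N C_def)
    define D where "D = C / (A * a1 * a2 * (A * a1 * a2))"
    have e1: "jtp_term q (Suc N) 0 = D * ((1 - q * (q ^ 2 * X ^ 2)) * (1 - q * (q * (q ^ 2 * X ^ 2))))"
      by (simp add: jtp_term_def jtp_coeff_def A2 C2 D_def del: mult_Suc_right)
    have e2: "jtp_term q N 0 = D * (a2 * a2)"
      using nn by (simp add: jtp_term_def jtp_coeff_def A1 C_def [symmetric] D_def)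
    have "jtp_term q N 1 = - (C / (qpoch q q m * qpoch q q (Suc N)))"
      using Suc by (simp add: jtp_term_def jtp_coeff_def C_def)
    hence e3: "jtp_term q N 1 = - (D * (a1 * a2))"
      unfolding A2 A_def [symmetric] D_def using nn by simp
    have "(1 - q * (q ^ 2 * X ^ 2)) * (1 - q * (q * (q ^ 2 * X ^ 2)))
       = (1 + q ^ 2 * X ^ 2 * q) * (a2 * a2) + 2 * (q * X * q) * (a1 * a2)"
      unfolding a1_def a2_def by algebra
    hence "D * ((1 - q * (q ^ 2 * X ^ 2)) * (1 - q * (q * (q ^ 2 * X ^ 2))))
       = (1 + q ^ 2 * X ^ 2 * q) * (D * (a2 * a2)) - 2 * (q * X * q) * - (D * (a1 * a2))"
      by algebra
    thus ?thesis unfolding e1 e2 e3 power_add q2N by simp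
  qed
qed

text \<open>A finite triple product. The symmetric sums z^n + y^n with y z = q replace negative
  powers of z, so z may be 0. The upper limit \<open>L\<close> is free above N, so that the
  induction step compares sums over the same range; the terms gained or lost by reindexing are
  0.\<close>

lemma jtp_finite:
  assumes q: "norm q < 1" and yz: "y * z = q"
  shows "N \<le> L \<Longrightarrow> qpoch z q N * qpoch y q N
     = jtp_term q N 0 + (\<Sum>n<L. jtp_term q N (Suc n) * (z ^ Suc n + y ^ Suc n))"
proof (induction N arbitrary: L)
  case 0
  thus ?case by (simp add: jtp_term_def jtp_coeff_def)
next
  case (Suc N)
  define d where "d = jtp_term q N"
  define e where "e = (\<lambda>n. z ^ n + y ^ n)"
  have d0: "d n = 0" if "n > N" for n
    using that by (simp add: d_def jtp_term_def jtp_coeff_def)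
  have ezy: "(z + y) * e (Suc n) = e (Suc (Suc n)) + q * e n" for n
    unfolding e_def yz [symmetric] by (simp add: algebra_simps)
  have S: "qpoch z q N * qpoch y q N = d 0 + (\<Sum>n<L. d (Suc n) * e (Suc n))"
    using Suc.IH [of L] Suc.prems by (simp add: d_def e_def)
  have first: "d 0 * e 1 + (\<Sum>n<L. d (Suc n) * e (Suc (Suc n))) = (\<Sum>n<L. d n * e (Suc n))"
  proof -
    have "d 0 * e 1 + (\<Sum>n<L. d (Suc n) * e (Suc (Suc n))) = (\<Sum>n<Suc L. d n * e (Suc n))"
      by (subst sum.lessThan_Suc_shift) simp
    also have "\<dots> = (\<Sum>n<L. d n * e (Suc n))" using d0 [of L] Suc.prems by simp
    finally show ?thesis .
  qed
  have second: "(\<Sum>n<L. d (Suc n) * e n) = 2 * d 1 + (\<Sum>n<L. d (Suc (Suc n)) * e (Suc n))"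
  proof -
    have "(\<Sum>n<L. d (Suc n) * e n) = (\<Sum>n<Suc L. d (Suc n) * e n)"
      using d0 [of "Suc L"] Suc.prems by simp
    also have "\<dots> = 2 * d 1 + (\<Sum>n<L. d (Suc (Suc n)) * e (Suc n))"
      by (subst sum.lessThan_Suc_shift) (simp add: e_def)
    finally show ?thesis .
  qed
  have "(z + y) * (d 0 + (\<Sum>n<L. d (Suc n) * e (Suc n)))
      = d 0 * e 1 + (\<Sum>n<L. d (Suc n) * ((z + y) * e (Suc n)))"
    by (simp add: e_def algebra_simps sum_distrib_left)
  also have "\<dots> = (d 0 * e 1 + (\<Sum>n<L. d (Suc n) * e (Suc (Suc n)))) + q * (\<Sum>n<L. d (Suc n) * e n)"
    unfolding ezy by (simp add: algebra_simps sum.distrib sum_distrib_left)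
  finally have zy: "(z + y) * (d 0 + (\<Sum>n<L. d (Suc n) * e (Suc n)))
      = (\<Sum>n<L. d n * e (Suc n)) + q * (2 * d 1 + (\<Sum>n<L. d (Suc (Suc n)) * e (Suc n)))"
    unfolding first second .
  have "qpoch z q (Suc N) * qpoch y q (Suc N)
      = (qpoch z q N * qpoch y q N) * ((1 - z * q ^ N) * (1 - y * q ^ N))"
    by (simp add: qpoch_Suc mult_ac)
  also have "(1 - z * q ^ N) * (1 - y * q ^ N) = (1 + q ^ (2 * N + 1)) - q ^ N * (z + y)"
  proof -
    have e: "q ^ (2 * N + 1) = y * z * (q ^ N * q ^ N)"
      unfolding yz by (simp add: mult_2 power_add)
    show ?thesis by (subst e) (simp add: algebra_simps)
  qed
  also have "(qpoch z q N * qpoch y q N) * ((1 + q ^ (2 * N + 1)) - q ^ N * (z + y))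
      = (1 + q ^ (2 * N + 1)) * (d 0 + (\<Sum>n<L. d (Suc n) * e (Suc n)))
        - q ^ N * ((z + y) * (d 0 + (\<Sum>n<L. d (Suc n) * e (Suc n))))"
    unfolding S by (simp only: right_diff_distrib mult_ac)
  also have "\<dots> = ((1 + q ^ (2 * N + 1)) * d 0 - 2 * q ^ (N + 1) * d 1)
      + (\<Sum>n<L. ((1 + q ^ (2 * N + 1)) * d (Suc n) - q ^ N * d n - q ^ (N + 1) * d (Suc (Suc n))) * e (Suc n))"
    unfolding zy by (simp add: algebra_simps sum.distrib sum_subtractf sum_distrib_left)
  also have "\<dots> = jtp_term q (Suc N) 0 + (\<Sum>n<L. jtp_term q (Suc N) (Suc n) * e (Suc n))"
    unfolding d_def jtp_term_rec_0 [OF q] jtp_term_rec [OF q] ..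
  finally show ?case by (simp only: e_def)
qed

lemma jtp_coeff_bound:
  assumes q: "norm q < 1"
  obtains K where "K \<ge> 0" "\<And>N n. norm (jtp_coeff q N n) \<le> K"
proof -
  define A where "A = exp (norm q / (1 - norm q))"
  define B where "B = exp (norm q / (1 - norm q) / (1 - norm q))"
  have "norm (jtp_coeff q N n) \<le> A * (B * B)" for N n
  proof (cases "n \<le> N")
    case True
    have "norm (jtp_coeff q N n) = norm (qpoch q q (2 * N))
        * (norm (inverse (qpoch q q (N - n))) * norm (inverse (qpoch q q (N + n))))"
      using True by (simp only: jtp_coeff_def if_True norm_mult divide_inverse inverse_mult_distrib)
    also have "\<dots> \<le> A * (B * B)"
      unfolding A_def B_def
      by (intro mult_mono' mult_nonneg_nonneg norm_ge_zero norm_qpoch_le norm_inverse_qpoch_le order_refl q)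
    finally show ?thesis .
  next
    case False
    have "0 \<le> A * (B * B)" by (simp add: A_def B_def)
    with False show ?thesis by (simp add: jtp_coeff_def)
  qed
  moreover have "A * (B * B) \<ge> 0" by (simp add: A_def B_def)
  ultimately show thesis using that by blast
qed

lemma jtp_coeff_tendsto:
  assumes q: "norm q < 1"
  shows "(\<lambda>N. jtp_coeff q N n) \<longlonglongrightarrow> inverse (qpoch_inf q q)"
proof -
  have nz: "qpoch_inf q q \<noteq> 0" by (rule qpoch_inf_nz [OF q q])
  have 1: "(\<lambda>N. qpoch q q (2 * N)) \<longlonglongrightarrow> qpoch_inf q q"
    by (rule qpoch_tendsto_mult [OF q]) simp
  have 2: "(\<lambda>N. qpoch q q (N - n)) \<longlonglongrightarrow> qpoch_inf q q"
    by (rule filterlim_compose [OF qpoch_tendsto [OF q] filterlim_minus_const_nat_at_top])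
  have 3: "(\<lambda>N. qpoch q q (N + n)) \<longlonglongrightarrow> qpoch_inf q q"
    by (rule LIMSEQ_ignore_initial_segment [OF qpoch_tendsto [OF q]])
  have "(\<lambda>N. qpoch q q (2 * N) / (qpoch q q (N - n) * qpoch q q (N + n)))
      \<longlonglongrightarrow> qpoch_inf q q / (qpoch_inf q q * qpoch_inf q q)"
    using nz by (intro tendsto_divide tendsto_mult 1 2 3) simp
  hence "(\<lambda>N. qpoch q q (2 * N) / (qpoch q q (N - n) * qpoch q q (N + n))) \<longlonglongrightarrow> inverse (qpoch_inf q q)"
    using nz by (simp add: field_simps)
  moreover have "eventually (\<lambda>N. qpoch q q (2 * N) / (qpoch q q (N - n) * qpoch q q (N + n)) = jtp_coeff q N n) sequentially"
    using eventually_ge_at_top [of n] by eventually_elim (simp add: jtp_coeff_def)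
  ultimately show ?thesis by (rule Lim_transform_eventually)
qed

text \<open>The limit of the finite form: each Gaussian coefficient tends to
  \<open>1/(q;q)_inf\<close>, and since these coefficients are bounded uniformly in both indices,
  the absolutely convergent theta terms supply the majorant for Tannery's theorem.\<close>

theorem jacobi_triple_product:
  assumes q: "norm q < 1" and yz: "y * z = q"
  shows "qpoch_inf q q * (qpoch_inf z q * qpoch_inf y q) = ptheta z q + ptheta y q - 1"
proof -
  define p where "p = (\<lambda>n. ptheta_term z q (Suc n) + ptheta_term y q (Suc n))"
  have sum_z: "summable (\<lambda>n. ptheta_term z q (Suc n))" and sum_y: "summable (\<lambda>n. ptheta_term y q (Suc n))"
    using summable_ptheta_term [OF q] by (simp_all only: summable_Suc_iff)
  have "suminf p = (\<Sum>n. ptheta_term z q (Suc n)) + (\<Sum>n. ptheta_term y q (Suc n))"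
    unfolding p_def by (rule suminf_add [OF sum_z sum_y, symmetric])
  hence sp: "suminf p = (ptheta z q - 1) + (ptheta y q - 1)"
    using suminf_split_head [OF summable_ptheta_term [OF q]] by (simp add: ptheta_def)
  obtain K where K: "K \<ge> 0" "\<And>N n. norm (jtp_coeff q N n) \<le> K"
    using jtp_coeff_bound [OF q] by blast
  define M where "M = (\<lambda>n. K * (norm (ptheta_term z q (Suc n)) + norm (ptheta_term y q (Suc n))))"
  have "summable M"
    unfolding M_def using summable_norm_ptheta_term [OF q]
    by (intro summable_mult summable_add) (simp_all only: summable_Suc_iff [of "\<lambda>n. norm (ptheta_term _ q n)"])
  have le: "norm (jtp_coeff q N (Suc n) * p n) \<le> M n" for N n
    unfolding norm_mult p_def M_def
    by (intro mult_mono' norm_ge_zero K norm_triangle_ineq)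
  have eq: "qpoch z q N * qpoch y q N = jtp_coeff q N 0 + (\<Sum>n. jtp_coeff q N (Suc n) * p n)" for N
  proof -
    have "(\<Sum>n. jtp_coeff q N (Suc n) * p n) = (\<Sum>n<N. jtp_coeff q N (Suc n) * p n)"
      by (rule suminf_finite) (auto simp: jtp_coeff_def)
    also have "\<dots> = (\<Sum>n<N. jtp_term q N (Suc n) * (z ^ Suc n + y ^ Suc n))"
      by (intro sum.cong refl) (simp only: p_def jtp_term_def ptheta_term_def distrib_left distrib_right mult_ac)
    finally show ?thesis
      using jtp_finite [OF q yz order_refl, of N] by (simp add: jtp_term_def)
  qed
  have lim: "(\<lambda>N. \<Sum>n. jtp_coeff q N (Suc n) * p n) \<longlonglongrightarrow> (\<Sum>n. inverse (qpoch_inf q q) * p n)"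
  proof -
    have "eventually (\<lambda>(n, N). norm (jtp_coeff q N (Suc n) * p n) \<le> M n) (at_top \<times>\<^sub>F sequentially)"
      using le by (intro always_eventually) auto
    moreover have "(\<lambda>N. jtp_coeff q N (Suc n) * p n) \<longlonglongrightarrow> inverse (qpoch_inf q q) * p n" for n
      by (rule tendsto_mult [OF jtp_coeff_tendsto [OF q] tendsto_const])
    ultimately show ?thesis
      using tannerys_theorem [of "\<lambda>n N. jtp_coeff q N (Suc n) * p n" _ sequentially M] \<open>summable M\<close>
      by simp
  qed
  have "(\<lambda>N. qpoch z q N * qpoch y q N)
      \<longlonglongrightarrow> inverse (qpoch_inf q q) + (\<Sum>n. inverse (qpoch_inf q q) * p n)"
    unfolding eq by (rule tendsto_add [OF jtp_coeff_tendsto [OF q] lim])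
  moreover have "(\<lambda>N. qpoch z q N * qpoch y q N) \<longlonglongrightarrow> qpoch_inf z q * qpoch_inf y q"
    by (rule tendsto_mult [OF qpoch_tendsto [OF q] qpoch_tendsto [OF q]])
  ultimately have "qpoch_inf z q * qpoch_inf y q
      = inverse (qpoch_inf q q) + (\<Sum>n. inverse (qpoch_inf q q) * p n)"
    using LIMSEQ_unique by blast
  also have "(\<Sum>n. inverse (qpoch_inf q q) * p n) = inverse (qpoch_inf q q) * suminf p"
    by (rule suminf_mult) (simp only: p_def summable_add [OF sum_z sum_y])
  finally have "qpoch_inf q q * (qpoch_inf z q * qpoch_inf y q) = 1 + suminf p"
    using qpoch_inf_nz [OF q q] by (simp add: field_simps)
  thus ?thesis unfolding sp by simp
qed

text \<open>Splitting the theta series into its even and odd parts turns one triple product in base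
  \<^term>\<open>- (q ^ 3)\<close> into two in base \<^term>\<open>q ^ 12\<close>.\<close>

lemma theta_dissection:
  assumes q: "norm q < 1" and s: "s ^ 2 = 1"
  shows "qpoch_inf (- (q ^ 3)) (- (q ^ 3)) * (qpoch_inf (s * q) (- (q ^ 3)) * qpoch_inf (- s * q ^ 2) (- (q ^ 3)))
       = J2 5 12 q - s * q * J2 1 12 q"
proof -
  define h where "h = (\<lambda>z. ptheta z (q ^ 12))"
  define Q where "Q = - (q ^ 3)"
  have Q: "norm Q < 1" using norm_power_less_1 [OF q, of 3] by (simp add: Q_def)
  have q12: "norm (q ^ 12) < 1" by (rule norm_power_less_1 [OF q]) simp
  have Q4: "Q ^ 4 = q ^ 12" by (simp add: Q_def power_mult [symmetric])
  have yz: "(- s * q ^ 2) * (s * q) = Q" unfolding Q_def using s by algebra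
  have a1: "- (Q * (s * q) ^ 2) = q ^ 5" unfolding Q_def using s by algebra
  have a2: "- (Q ^ 3 * (s * q) ^ 2) = q ^ 11" unfolding Q_def using s by algebra
  have a3: "- (Q * (- s * q ^ 2) ^ 2) = q ^ 7" unfolding Q_def using s by algebra
  have a4: "- (Q ^ 3 * (- s * q ^ 2) ^ 2) = q * q ^ 12" unfolding Q_def using s by algebra
  have "qpoch_inf Q Q * (qpoch_inf (s * q) Q * qpoch_inf (- s * q ^ 2) Q)
      = ptheta (s * q) Q + ptheta (- s * q ^ 2) Q - 1"
    by (rule jacobi_triple_product [OF Q yz])
  also have "\<dots> = (h (q ^ 5) - s * q * h (q ^ 11)) + (h (q ^ 7) - - s * q ^ 2 * h (q * q ^ 12)) - 1"
    unfolding ptheta_even_odd [OF Q, of "s * q"] ptheta_even_odd [OF Q, of "- s * q ^ 2"] a1 a2 a3 a4 Q4 h_def ..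
  also have "\<dots> = (h (q ^ 5) + h (q ^ 7) - 1) - s * q * (h (q ^ 11) + h q - 1)"
  proof -
    \<comment> \<open>The last odd part sits at q^13, whereas the partner of q^11 in base q^12 is q.
      The shift brings it there and also provides the second -1, so that each pair becomes a
      complete triple product.\<close>
    have "h q - 1 = - q * h (q * q ^ 12)" unfolding h_def by (rule ptheta_shift [OF q12])
    thus ?thesis by algebra
  qed
  also have "h (q ^ 5) + h (q ^ 7) - 1 = J2 5 12 q"
    using jacobi_triple_product [OF q12, of "q ^ 7" "q ^ 5"]
    by (simp add: h_def J2_def power_add [symmetric] mult_ac)
  also have "h (q ^ 11) + h q - 1 = J2 1 12 q"
    using jacobi_triple_product [OF q12, of "q" "q ^ 11"]
    by (simp add: h_def J2_def power_Suc [symmetric] mult_ac del: power_Suc)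
  finally show ?thesis by (simp only: Q_def)
qed

section \<open>Evaluation at the cube root of unity\<close>

lemma qpoch_cube:
  assumes w: "w ^ 2 + w + 1 = 0"
  shows "qpoch a p n * qpoch (w * a) p n * qpoch (w ^ 2 * a) p n = qpoch (a ^ 3) (p ^ 3) n"
proof -
  have "(1 - u) * (1 - w * u) * (1 - w ^ 2 * u) = 1 - u ^ 3" for u
    using w by algebra
  from this [of "a * p ^ _"] show ?thesis
    unfolding qpoch_def prod.distrib [symmetric]
    by (intro prod.cong refl) (simp add: power_mult_distrib power_mult [symmetric] mult_ac)
qed

lemma qpoch_inf_cube:
  assumes w: "w ^ 2 + w + 1 = 0" and p: "norm p < 1"
  shows "qpoch_inf a p * qpoch_inf (w * a) p * qpoch_inf (w ^ 2 * a) p = qpoch_inf (a ^ 3) (p ^ 3)"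
proof (rule qpoch_inf_eqI [symmetric])
  show "qpoch (a ^ 3) (p ^ 3) \<longlonglongrightarrow> qpoch_inf a p * qpoch_inf (w * a) p * qpoch_inf (w ^ 2 * a) p"
    unfolding qpoch_cube [OF w, symmetric] by (intro tendsto_mult qpoch_tendsto p)
qed (rule norm_power_less_1 [OF p], simp)

text \<open>Euler's theorem on distinct versus odd parts. Both
  \<open>(p;p^2)_inf (p^2;p^2)_inf\<close> and \<open>(p^2;p^2)_inf / (-p;p)_inf\<close> are
  \<open>(p;p)_inf\<close>.\<close>

lemma qpoch_inf_euler:
  assumes p: "norm p < 1"
  shows "qpoch_inf (- p) p * qpoch_inf p (p ^ 2) = 1"
proof -
  have p2: "norm (p ^ 2) < 1" by (rule norm_power_less_1 [OF p]) simp
  have "qpoch_inf (p ^ 2) (p ^ 2) * (qpoch_inf (- p) p * qpoch_inf p (p ^ 2))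
      = (qpoch_inf p (p ^ 2) * qpoch_inf (p * p) (p ^ 2)) * qpoch_inf (- p) p"
    by (simp add: power2_eq_square mult_ac)
  also have "\<dots> = qpoch_inf (p ^ 2) (p ^ 2)"
    unfolding qpoch_inf_split2 [OF p, symmetric] by (rule qpoch_inf_mult_minus [OF p])
  finally show ?thesis using qpoch_inf_nz [OF p2 p2] by simp
qed

text \<open>The general term of T_0 in the notation of the overview; T_k carries the extra factor
  q^(kn).\<close>

definition base_term :: "complex \<Rightarrow> complex \<Rightarrow> nat \<Rightarrow> complex" where
  "base_term w q n = (qpoch (- w) q n * qpoch (- (w ^ 2)) (q ^ 2) n)
     / (qpoch (w ^ 2 * q) (q ^ 2) n * qpoch (q ^ 3) (q ^ 3) n) * w ^ n * q ^ (n * (n + 1) div 2)"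

context
  fixes w q :: complex
  assumes w: "w ^ 2 + w + 1 = 0" and nw: "norm w = 1" and q: "norm q < 1"
begin

lemma w3: "w ^ 3 = 1"
  using w by algebra

lemma norm_q_power: "k > 0 \<Longrightarrow> norm (q ^ k) < 1"
  by (rule norm_power_less_1 [OF q])

lemma norm_q_power_pow: "k > 0 \<Longrightarrow> norm (c :: complex) = 1 \<Longrightarrow> norm (c * q ^ k) < 1"
  using norm_q_power by (simp add: norm_mult)

text \<open>With s = -1 the three factors of the dissected theta product are the residue classes
  modulo 3 of \<open>(-q;-q)_inf\<close>, since -q, q^2 and -q^3 are the first three powers of
  -q.\<close>

lemma omega_sum_theta:
  "suminf (omega_term w q w) * (J1 3 q * qpoch_inf (w * q ^ 2) (q ^ 4)) = w * (J2 5 12 q + q * J2 1 12 q)"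
proof -
  define A where "A = suminf (omega_term w q w)"
  have q2: "norm (q ^ 2) < 1" by (rule norm_q_power) simp
  have mq: "norm (- q) < 1" using q by simp
  have "J2 5 12 q + q * J2 1 12 q = qpoch_inf (- (q ^ 3)) (- (q ^ 3))
      * (qpoch_inf (- q) (- (q ^ 3)) * qpoch_inf (q ^ 2) (- (q ^ 3)))"
    using theta_dissection [OF q, of "- 1"] by simp
  also have "\<dots> = qpoch_inf (- q) (- q)"
    using qpoch_inf_split3 [OF mq, of "- q"]
    by (simp add: power2_eq_square [symmetric] power_minus_odd mult_ac)
       (simp add: power2_eq_square power3_eq_cube mult_ac)
  also have "\<dots> = qpoch_inf (- q) (q ^ 2) * qpoch_inf (q ^ 2) (q ^ 2)"
    using qpoch_inf_split2 [OF mq, of "- q"] by (simp add: power2_eq_square)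
  finally have P: "J2 5 12 q + q * J2 1 12 q = qpoch_inf (- q) (q ^ 2) * qpoch_inf (q ^ 2) (q ^ 2)" .
  have w4: "(w ^ 2 * q) ^ 2 = w * q ^ 2" using w by algebra
  have J: "J1 3 q = qpoch_inf q q * qpoch_inf (w * q) q * qpoch_inf (w ^ 2 * q) q"
    unfolding J1_def by (rule qpoch_inf_cube [OF w q, symmetric])
  have m1: "qpoch_inf q q * qpoch_inf (- q) q = qpoch_inf (q ^ 2) (q ^ 2)"
    by (rule qpoch_inf_mult_minus [OF q])
  have m2: "qpoch_inf (w ^ 2 * q) q * (qpoch_inf (- (w ^ 2 * q)) (q ^ 2) * qpoch_inf (- (w ^ 2 * q ^ 2)) (q ^ 2))
      = qpoch_inf (w * q ^ 2) (q ^ 2)"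
    using qpoch_inf_mult_minus [OF q, of "w ^ 2 * q"] qpoch_inf_split2 [OF q, of "- (w ^ 2 * q)"]
    by (simp add: w4 power2_eq_square [of q] mult.assoc)
  \<comment> \<open>The origin of the denominator \<open>(w q^2;q^4)_inf\<close>: the product
    \<open>(w^2q;q^2)_inf\<close> is completed by its counterpart of opposite sign, and (w^2 q)^2 =
    w q^2.\<close>
  have m3: "qpoch_inf (w ^ 2 * q) (q ^ 2) * qpoch_inf (- (w ^ 2 * q)) (q ^ 2) = qpoch_inf (w * q ^ 2) (q ^ 4)"
    using qpoch_inf_mult_minus [OF q2, of "w ^ 2 * q"] by (simp add: w4)
  have ww: "w ^ 2 * w * q = q" using w by algebra
  have ww2: "w * w * q ^ 2 = w ^ 2 * q ^ 2" by (simp add: power2_eq_square)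
  have S: "qpoch_inf (w ^ 2 * q) (q ^ 2) * qpoch_inf (w * q ^ 2) (q ^ 2) * qpoch_inf (w * q) q * A
     = w * qpoch_inf (- q) q * qpoch_inf (- q) (q ^ 2) * qpoch_inf (- (w ^ 2 * q ^ 2)) (q ^ 2)"
    using omega_sum [OF w nw q, of w] unfolding ww ww2 A_def by (simp add: nw)
  have nz: "qpoch_inf (w * q ^ 2) (q ^ 2) \<noteq> 0"
    using norm_q_power_pow [of 2 w] by (intro qpoch_inf_nz q2) (simp add: nw)
  have "qpoch_inf (w * q ^ 2) (q ^ 2) * (A * (J1 3 q * qpoch_inf (w * q ^ 2) (q ^ 4)))
     = (qpoch_inf (w ^ 2 * q) (q ^ 2) * qpoch_inf (w * q ^ 2) (q ^ 2) * qpoch_inf (w * q) q * A)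
        * (qpoch_inf q q * qpoch_inf (w ^ 2 * q) q * qpoch_inf (- (w ^ 2 * q)) (q ^ 2))"
    unfolding J m3 [symmetric] by (simp only: mult_ac)
  also have "\<dots> = w * (qpoch_inf q q * qpoch_inf (- q) q) * qpoch_inf (- q) (q ^ 2)
        * (qpoch_inf (w ^ 2 * q) q * (qpoch_inf (- (w ^ 2 * q)) (q ^ 2) * qpoch_inf (- (w ^ 2 * q ^ 2)) (q ^ 2)))"
    unfolding S by (simp only: mult_ac)
  also have "\<dots> = qpoch_inf (w * q ^ 2) (q ^ 2) * (w * (qpoch_inf (- q) (q ^ 2) * qpoch_inf (q ^ 2) (q ^ 2)))"
    unfolding m1 m2 by (simp only: mult_ac)
  finally show ?thesis using nz unfolding P A_def by simp
qed

text \<open>This removes \<open>w\<close> from the evaluated product, so that it matches the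
  dissected theta product split into base q^6. Multiplied by \<open>(-q;q^2)_inf\<close>, both sides
  become \<open>(-q^3;q^6)_inf\<close>: the left one by the cube identity, the right one by
  splitting modulo 3 and Euler's theorem in bases q^2 and q^6.\<close>

lemma cubic_product_identity:
  "qpoch_inf (- (w * q)) (q ^ 2) * qpoch_inf (- (w ^ 2 * q)) (q ^ 2)
   = qpoch_inf q (q ^ 6) * qpoch_inf (- (q ^ 4)) (q ^ 6) * (qpoch_inf (- (q ^ 2)) (q ^ 6) * qpoch_inf (q ^ 5) (q ^ 6))"
proof -
  define E where "E = (\<lambda>a. qpoch_inf a (q ^ 6))"
  define G where "G = (\<lambda>a. qpoch_inf a (q ^ 12))"
  have q2: "norm (q ^ 2) < 1" and q4: "norm (q ^ 4) < 1" and q6: "norm (q ^ 6) < 1"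
    by (rule norm_q_power; simp)+
  have pw: "(q ^ 2) ^ 2 = q ^ 4" "(q ^ 2) ^ 3 = q ^ 6" "(q ^ 6) ^ 2 = q ^ 12" "(q ^ 4) ^ 3 = q ^ 12"
    "(q ^ 5) ^ 2 = q ^ 10" "(q ^ 4) ^ 2 = q ^ 8"
    by (simp_all flip: power_mult)
  have ps: "q * q ^ 2 = q ^ 3" "q * q ^ 4 = q ^ 5" "q ^ 2 * q ^ 2 = q ^ 4" "q ^ 2 * q ^ 4 = q ^ 6"
    "q ^ 2 * q ^ 8 = q ^ 10"
    by (simp_all flip: power_add power_Suc)
  have cube: "qpoch_inf (- q) (q ^ 2) * (qpoch_inf (- (w * q)) (q ^ 2) * qpoch_inf (- (w ^ 2 * q)) (q ^ 2)) = E (- (q ^ 3))"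
    using qpoch_inf_cube [OF w q2, of "- q"] by (simp add: pw E_def mult.assoc)
  have s1: "qpoch_inf (- q) (q ^ 2) = E (- q) * E (- (q ^ 3)) * E (- (q ^ 5))"
    using qpoch_inf_split3 [OF q2, of "- q"] by (simp add: pw ps E_def)
  have s2: "qpoch_inf (- (q ^ 2)) (q ^ 2) = E (- (q ^ 2)) * E (- (q ^ 4)) * E (- (q ^ 6))"
    using qpoch_inf_split3 [OF q2, of "- (q ^ 2)"] by (simp add: pw ps E_def)
  have s3: "qpoch_inf (q ^ 2) (q ^ 4) = G (q ^ 2) * G (q ^ 6) * G (q ^ 10)"
    using qpoch_inf_split3 [OF q4, of "q ^ 2"] by (simp add: pw ps G_def)
  have d1: "E q * E (- q) = G (q ^ 2)"
    using qpoch_inf_mult_minus [OF q6, of q] by (simp add: pw E_def G_def)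
  have d5: "E (q ^ 5) * E (- (q ^ 5)) = G (q ^ 10)"
    using qpoch_inf_mult_minus [OF q6, of "q ^ 5"] by (simp add: pw E_def G_def)
  have e2: "qpoch_inf (- (q ^ 2)) (q ^ 2) * qpoch_inf (q ^ 2) (q ^ 4) = 1"
    using qpoch_inf_euler [OF q2] by (simp add: pw)
  have e6: "E (- (q ^ 6)) * G (q ^ 6) = 1"
    using qpoch_inf_euler [OF q6] by (simp add: pw E_def G_def)
  have "qpoch_inf (- q) (q ^ 2) * (E q * E (- (q ^ 4)) * (E (- (q ^ 2)) * E (q ^ 5)))
      = (E q * E (- q)) * (E (q ^ 5) * E (- (q ^ 5))) * E (- (q ^ 2)) * E (- (q ^ 4)) * E (- (q ^ 3))"
    unfolding s1 by (simp only: mult_ac)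
  \<comment> \<open>The inserted product is 1 by Euler's theorem in base q^6. It supplies the
    residue class needed to reassemble \<open>(-q^2;q^2)_inf\<close> and
    \<open>(q^2;q^4)_inf\<close>, whose product is again 1.\<close>
  also have "\<dots> = (E (- (q ^ 6)) * G (q ^ 6))
      * (G (q ^ 2) * G (q ^ 10) * E (- (q ^ 2)) * E (- (q ^ 4)) * E (- (q ^ 3)))"
    unfolding d1 d5 e6 by (simp only: mult_ac mult_1_left)
  also have "\<dots> = (qpoch_inf (- (q ^ 2)) (q ^ 2) * qpoch_inf (q ^ 2) (q ^ 4)) * E (- (q ^ 3))"
    unfolding s2 s3 by (simp only: mult_ac)
  also have "\<dots> = E (- (q ^ 3))" unfolding e2 by simp
  finally have "qpoch_inf (- q) (q ^ 2) * (E q * E (- (q ^ 4)) * (E (- (q ^ 2)) * E (q ^ 5)))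
      = qpoch_inf (- q) (q ^ 2) * (qpoch_inf (- (w * q)) (q ^ 2) * qpoch_inf (- (w ^ 2 * q)) (q ^ 2))"
    unfolding cube .
  moreover have "qpoch_inf (- q) (q ^ 2) \<noteq> 0"
    using q by (intro qpoch_inf_nz q2) simp
  ultimately show ?thesis unfolding E_def by simp
qed

lemma cubic_sum_theta:
  "suminf (cubic_term q w) * (J1 3 q * qpoch_inf (w * q ^ 2) (q ^ 4)) = J2 5 12 q - q * J2 1 12 q"
proof -
  define B where "B = suminf (cubic_term q w)"
  have q2: "norm (q ^ 2) < 1" and q3: "norm (q ^ 3) < 1" by (rule norm_q_power; simp)+
  have mq3: "norm (- (q ^ 3)) < 1" using q3 by (simp only: norm_minus_cancel)
  have pw: "(- (q ^ 3)) ^ 2 = q ^ 6" "(q ^ 3) ^ 2 = q ^ 6" by (simp_all flip: power_mult)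
  have ps: "q * q ^ 3 = q ^ 4" "q ^ 2 * q ^ 3 = q ^ 5" "q ^ 3 * q ^ 3 = q ^ 6"
    by (simp_all flip: power_add power_Suc)
  have "J2 5 12 q - q * J2 1 12 q = qpoch_inf (- (q ^ 3)) (- (q ^ 3))
      * (qpoch_inf q (- (q ^ 3)) * qpoch_inf (- (q ^ 2)) (- (q ^ 3)))"
    using theta_dissection [OF q, of 1] by simp
  also have "\<dots> = (qpoch_inf (- (q ^ 3)) (q ^ 6) * qpoch_inf (q ^ 6) (q ^ 6))
      * (qpoch_inf q (q ^ 6) * qpoch_inf (- (q ^ 4)) (q ^ 6) * (qpoch_inf (- (q ^ 2)) (q ^ 6) * qpoch_inf (q ^ 5) (q ^ 6)))"
    using qpoch_inf_split2 [OF mq3, of "- (q ^ 3)"] qpoch_inf_split2 [OF mq3, of q]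
      qpoch_inf_split2 [OF mq3, of "- (q ^ 2)"]
    by (simp add: pw ps)
  finally have M: "J2 5 12 q - q * J2 1 12 q = (qpoch_inf (- (q ^ 3)) (q ^ 6) * qpoch_inf (q ^ 6) (q ^ 6))
      * (qpoch_inf (- (w * q)) (q ^ 2) * qpoch_inf (- (w ^ 2 * q)) (q ^ 2))"
    unfolding cubic_product_identity .
  have w4: "(w ^ 2 * q) ^ 2 = w * q ^ 2" using w by algebra
  have m3: "qpoch_inf (w ^ 2 * q) (q ^ 2) * qpoch_inf (- (w ^ 2 * q)) (q ^ 2) = qpoch_inf (w * q ^ 2) (q ^ 4)"
    using qpoch_inf_mult_minus [OF q2, of "w ^ 2 * q"] by (simp add: w4)
  have J: "J1 3 q = qpoch_inf (q ^ 3) (q ^ 6) * qpoch_inf (q ^ 6) (q ^ 6)"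
    unfolding J1_def using qpoch_inf_split2 [OF q3, of "q ^ 3"] by (simp add: pw ps)
  have S: "qpoch_inf (w ^ 2 * q) (q ^ 2) * qpoch_inf (q ^ 3) (q ^ 6) * B
      = qpoch_inf (- (w * q)) (q ^ 2) * qpoch_inf (- (q ^ 3)) (q ^ 6)"
    using cubic_sum [OF q, of w] unfolding w3 B_def by (simp add: nw)
  have "B * (J1 3 q * qpoch_inf (w * q ^ 2) (q ^ 4))
      = (qpoch_inf (w ^ 2 * q) (q ^ 2) * qpoch_inf (q ^ 3) (q ^ 6) * B)
         * (qpoch_inf (q ^ 6) (q ^ 6) * qpoch_inf (- (w ^ 2 * q)) (q ^ 2))"
    unfolding J m3 [symmetric] by (simp only: mult_ac)
  also have "\<dots> = J2 5 12 q - q * J2 1 12 q"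
    unfolding S M by (simp only: mult_ac)
  finally show ?thesis unfolding B_def .
qed

section \<open>Recovering the two series from the two evaluations\<close>

lemma prod_w_plus: "(\<Prod>j<n. w + c j) = w ^ n * (\<Prod>j<n. 1 + w ^ 2 * c j)"
proof -
  have "w + u = w * (1 + w ^ 2 * u)" for u using w by algebra
  hence "(\<Prod>j<n. w + c j) = (\<Prod>j<n. w * (1 + w ^ 2 * c j))" by (intro prod.cong) auto
  thus ?thesis by (simp add: prod.distrib)
qed

lemma omega_term_w: "omega_term w q w n = base_term w q n * (1 + w * q ^ n) ^ 2"
proof -
  have P: "(\<Prod>j<n. w + q ^ (2 * j)) = w ^ n * qpoch (- (w ^ 2)) (q ^ 2) n"
    unfolding prod_w_plus by (simp add: qpoch_def power_mult)
  have "qpoch q q n * qpoch (w * q) q n * qpoch (w ^ 2 * q) q n = qpoch (q ^ 3) (q ^ 3) n"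
    by (rule qpoch_cube [OF w])
  hence D: "qpoch (w ^ 2 * q) (q ^ 2) n * qpoch q q n * qpoch (w ^ 2 * q) q n * qpoch (w * q) q n
      = qpoch (w ^ 2 * q) (q ^ 2) n * qpoch (q ^ 3) (q ^ 3) n"
    by (metis mult.assoc mult.commute)
  have "omega_base w q w n = base_term w q n"
    unfolding omega_base_def P D base_term_def by (simp add: mult_ac)
  thus ?thesis by (simp add: omega_term_def)
qed

text \<open>At x = w the family contains \<open>(-w^2q^2;q^2)_n\<close>, one step ahead of
  \<open>(-w^2;q^2)_n\<close>. Moving back costs the first factor 1 + w^2 and gains the last one,
  which is the weight 1 + w^2 q^(2n).\<close>

lemma cubic_term_w: "(1 + w ^ 2) * cubic_term q w n = base_term w q n * (1 + w ^ 2 * (q ^ n) ^ 2)"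
proof -
  have "(\<Prod>j<n. w + q ^ (2 * j + 2)) = w ^ n * qpoch (- (w ^ 2) * q ^ 2) (q ^ 2) n"
  proof -
    have "q ^ (2 * j + 2) = q ^ 2 * (q ^ 2) ^ j" for j
      unfolding power_add power_mult by (rule mult.commute)
    thus ?thesis unfolding prod_w_plus qpoch_def by (simp add: mult.assoc)
  qed
  moreover have "(1 + w ^ 2) * qpoch (- (w ^ 2) * q ^ 2) (q ^ 2) n = qpoch (- (w ^ 2)) (q ^ 2) n * (1 + w ^ 2 * (q ^ n) ^ 2)"
  proof -
    have "(1 + w ^ 2) * qpoch (- (w ^ 2) * q ^ 2) (q ^ 2) n = qpoch (- (w ^ 2)) (q ^ 2) (Suc n)"
      by (simp add: qpoch_Suc_left)
    also have "\<dots> = qpoch (- (w ^ 2)) (q ^ 2) n * (1 + w ^ 2 * (q ^ n) ^ 2)"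
      by (simp add: qpoch_Suc power_mult [symmetric] mult.commute)
    finally show ?thesis .
  qed
  ultimately show ?thesis unfolding cubic_term_def base_term_def by (simp add: mult_ac)
qed

text \<open>With u = q^(n+1), the weight w^2 + u + w u^2 equals w^2 (1 - u^3)/(1 - w u). It trades
  the last factor of \<open>(q^3;q^3)_(n+1)\<close> for the last factor of
  \<open>(wq;q)_(n+1)\<close>. In the numerator the leading factors cancel by (1 + w)(1 + w^2) = 1,
  and multiplication by \<open>(wq;q)_n\<close> collapses the rest to \<open>(wq^4;q^4)_n\<close>
  through two differences of squares.\<close>

lemma base_term_shift:
  "base_term w q (Suc n) * (w ^ 2 + q ^ Suc n + w * (q ^ Suc n) ^ 2)
   = q * (qpoch (w * q ^ 4) (q ^ 4) n
       / (qpoch (q ^ 3) (q ^ 3) n * qpoch (w * q) q (n + 1) * qpoch (w ^ 2 * q) (q ^ 2) (n + 1))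
       * w ^ n * q ^ (n * (n + 3) div 2))"
proof -
  define u where "u = q ^ Suc n"
  define V where "V = qpoch (w * q) q n"
  define N1 where "N1 = qpoch (- w * q) q n"
  define N2 where "N2 = qpoch (- (w ^ 2) * q ^ 2) (q ^ 2) n"
  define D1 where "D1 = qpoch (w ^ 2 * q) (q ^ 2) (Suc n)"
  define D3 where "D3 = qpoch (q ^ 3) (q ^ 3) n"
  have V: "V \<noteq> 0" unfolding V_def
    using q by (intro qpoch_nz) (simp_all add: norm_mult nw)
  have u: "norm u < 1" unfolding u_def by (rule norm_q_power) simp
  have u1: "1 - w * u \<noteq> 0" using u by (intro one_minus_nz) (simp add: norm_mult nw)
  have u3: "1 - u ^ 3 \<noteq> 0" by (intro one_minus_nz norm_power_less_1 [OF u]) simp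
  have w1: "(1 + w) * (1 + w ^ 2) = 1" using w by algebra
  have num: "qpoch (- w) q (Suc n) * qpoch (- (w ^ 2)) (q ^ 2) (Suc n) = N1 * N2"
  proof -
    have "qpoch (- w) q (Suc n) * qpoch (- (w ^ 2)) (q ^ 2) (Suc n) = ((1 + w) * (1 + w ^ 2)) * (N1 * N2)"
      unfolding qpoch_Suc_left N1_def N2_def by (simp add: mult_ac)
    thus ?thesis unfolding w1 by simp
  qed
  have D3: "qpoch (q ^ 3) (q ^ 3) (Suc n) = D3 * (1 - u ^ 3)"
    unfolding qpoch_Suc D3_def u_def by (simp add: power_mult_distrib power_mult [symmetric] mult_ac)
  have V1: "qpoch (w * q) q (Suc n) = V * (1 - w * u)"
    by (simp add: qpoch_Suc V_def u_def mult_ac)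
  have W4: "qpoch (w * q ^ 4) (q ^ 4) n = V * N1 * N2"
  proof -
    have "V * N1 = qpoch (w ^ 2 * q ^ 2) (q ^ 2) n"
      using qpoch_mult_minus [of "w * q" q n] by (simp add: V_def N1_def power_mult_distrib)
    hence "V * N1 * N2 = qpoch ((w ^ 2 * q ^ 2) ^ 2) ((q ^ 2) ^ 2) n"
      using qpoch_mult_minus [of "w ^ 2 * q ^ 2" "q ^ 2" n] by (simp add: N2_def)
    also have "(w ^ 2 * q ^ 2) ^ 2 = w * q ^ 4" using w by algebra
    also have "(q ^ 2) ^ 2 = q ^ 4" by (simp flip: power_mult)
    finally show ?thesis by simp
  qed
  have poly: "w ^ 2 + u + w * u ^ 2 = w ^ 2 * ((1 - u ^ 3) / (1 - w * u))"
  proof -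
    have "(w ^ 2 + u + w * u ^ 2) * (1 - w * u) = w ^ 2 * (1 - u ^ 3)" using w by algebra
    thus ?thesis using u1 by (simp add: field_simps)
  qed
  have pow: "q ^ (Suc n * (Suc n + 1) div 2) = q * q ^ (n * (n + 3) div 2)"
  proof -
    have "Suc n * (Suc n + 1) = n * (n + 3) + 2" by (simp add: algebra_simps)
    hence "Suc n * (Suc n + 1) div 2 = Suc (n * (n + 3) div 2)" by simp
    thus ?thesis by (simp only: power_Suc)
  qed
  have "base_term w q (Suc n) * (w ^ 2 + u + w * u ^ 2)
      = N1 * N2 / (D1 * (D3 * (1 - u ^ 3))) * (w * w ^ n) * (q * q ^ (n * (n + 3) div 2))
        * (w ^ 2 * ((1 - u ^ 3) / (1 - w * u)))"
    unfolding base_term_def num D3 D1_def [symmetric] pow poly power_Suc ..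
  also have "\<dots> = w ^ 3 * (q * (N1 * N2 / (D3 * (1 - w * u) * D1) * w ^ n * q ^ (n * (n + 3) div 2)))"
    using u3 by (simp add: power3_eq_cube power2_eq_square mult_ac)
  also have "\<dots> = q * (V * N1 * N2 / (D3 * (V * (1 - w * u)) * D1) * w ^ n * q ^ (n * (n + 3) div 2))"
    unfolding w3 using V by simp
  finally show ?thesis
    unfolding D1_def D3_def [symmetric] W4 V1 [symmetric] unfolding u_def Suc_eq_plus1 .
qed

lemma base_term_sums:
  defines "D \<equiv> J1 3 q * qpoch_inf (w * q ^ 2) (q ^ 4)"
  shows "(\<lambda>n. base_term w q n * q ^ n) sums (J2 5 12 q / D)"
    and "(\<lambda>n. base_term w q n * (w ^ 2 + q ^ n + w * (q ^ n) ^ 2)) sums (q * J2 1 12 q / D)"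
proof -
  define A where "A = suminf (omega_term w q w)"
  define B where "B = suminf (cubic_term q w)"
  have "norm (w * q ^ 2) < 1" by (rule norm_q_power_pow) (simp_all add: nw)
  hence D: "D \<noteq> 0"
    unfolding D_def J1_def using norm_q_power [of 3] norm_q_power [of 4] qpoch_inf_nz by simp
  have A: "A = w * (J2 5 12 q + q * J2 1 12 q) / D"
    using omega_sum_theta D unfolding A_def D_def by (metis nonzero_mult_div_cancel_right)
  have B: "B = (J2 5 12 q - q * J2 1 12 q) / D"
    using cubic_sum_theta D unfolding B_def D_def by (metis nonzero_mult_div_cancel_right)
  have w0: "w \<noteq> 0" using nw by auto
  have w2: "1 + w ^ 2 = - w" using w by algebra
  have sA: "(\<lambda>n. base_term w q n * (1 + w * q ^ n) ^ 2) sums A"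
    using summable_sums [OF summable_omega_term [OF w nw q, of w]] unfolding A_def omega_term_w by (simp add: nw)
  have sB: "(\<lambda>n. base_term w q n * (1 + w ^ 2 * (q ^ n) ^ 2)) sums ((1 + w ^ 2) * B)"
    using sums_mult [OF summable_sums [OF summable_cubic_term [OF q, of w]], of "1 + w ^ 2"]
    unfolding B_def cubic_term_w by (simp add: nw)
  \<comment> \<open>The two weights differ by 2 w q^n, so this difference isolates T_1.\<close>
  have "(\<lambda>n. (base_term w q n * (1 + w * q ^ n) ^ 2 - base_term w q n * (1 + w ^ 2 * (q ^ n) ^ 2)) / (2 * w))
      sums ((A - (1 + w ^ 2) * B) / (2 * w))"
    by (rule sums_divide [OF sums_diff [OF sA sB]])
  moreover have "(base_term w q n * (1 + w * q ^ n) ^ 2 - base_term w q n * (1 + w ^ 2 * (q ^ n) ^ 2)) / (2 * w)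
      = base_term w q n * q ^ n" for n
  proof -
    have "base_term w q n * (1 + w * q ^ n) ^ 2 - base_term w q n * (1 + w ^ 2 * (q ^ n) ^ 2)
        = base_term w q n * q ^ n * (2 * w)"
      by (simp add: power2_eq_square algebra_simps)
    thus ?thesis using w0 by simp
  qed
  moreover have "(A - (1 + w ^ 2) * B) / (2 * w) = J2 5 12 q / D"
    unfolding w2 A B using w0 D by (simp add: field_simps)
  ultimately show s1: "(\<lambda>n. base_term w q n * q ^ n) sums (J2 5 12 q / D)" by simp
  \<comment> \<open>Because w^4 = w, the sum w^2 T_0 + T_1 + w T_2 is w^2 (T_0 + w^2 T_2) + T_1; no
    separate values of T_0 and T_2 are required.\<close>
  have "(\<lambda>n. w ^ 2 * (base_term w q n * (1 + w ^ 2 * (q ^ n) ^ 2)) + base_term w q n * q ^ n)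
      sums (w ^ 2 * ((1 + w ^ 2) * B) + J2 5 12 q / D)"
    by (rule sums_add [OF sums_mult [OF sB] s1])
  moreover have "w ^ 2 * (base_term w q n * (1 + w ^ 2 * (q ^ n) ^ 2)) + base_term w q n * q ^ n
      = base_term w q n * (w ^ 2 + q ^ n + w * (q ^ n) ^ 2)" for n
  proof -
    have "w ^ 2 * (b * (1 + w ^ 2 * u ^ 2)) + b * u = b * (w ^ 2 + u + w * u ^ 2)" for b u
      using w by algebra
    thus ?thesis .
  qed
  moreover have "w ^ 2 * ((1 + w ^ 2) * B) + J2 5 12 q / D = q * J2 1 12 q / D"
  proof -
    \<comment> \<open>Since 1 + w^2 = - w, the factor is - w^3 = -1. Then \<open>J2 5 12 q\<close>
      cancels and only the odd half of the theta series survives.\<close>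
    have "w ^ 2 * ((1 + w ^ 2) * B) = - B" using w by algebra
    thus ?thesis unfolding B by (simp add: diff_divide_distrib)
  qed
  ultimately show "(\<lambda>n. base_term w q n * (w ^ 2 + q ^ n + w * (q ^ n) ^ 2)) sums (q * J2 1 12 q / D)"
    by simp
qed

end

theorem theorem4p2:
  fixes \<omega> q :: complex
  assumes "primitive_root_of_unity 3 \<omega>"
    and "norm q < 1"
  shows "(\<lambda>n. (qpoch (- \<omega>) q n * qpoch (- (\<omega> ^ 2)) (q ^ 2) n)
              / (qpoch (\<omega> ^ 2 * q) (q ^ 2) n * qpoch (q ^ 3) (q ^ 3) n)
              * \<omega> ^ n * q ^ (n * (n + 3) div 2))
           sums (J2 5 12 q / (J1 3 q * qpoch_inf (\<omega> * q ^ 2) (q ^ 4)))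
       \<and> (\<lambda>n. qpoch (\<omega> * q ^ 4) (q ^ 4) n
              / (qpoch (q ^ 3) (q ^ 3) n * qpoch (\<omega> * q) q (n + 1) * qpoch (\<omega> ^ 2 * q) (q ^ 2) (n + 1))
              * \<omega> ^ n * q ^ (n * (n + 3) div 2))
           sums (J2 1 12 q / (J1 3 q * qpoch_inf (\<omega> * q ^ 2) (q ^ 4)))"
    (is "?f sums _ \<and> ?g sums _")
proof
  have w3: "\<omega> ^ 3 = 1" and "\<omega> ^ 1 \<noteq> 1"
    using assms(1) unfolding primitive_root_of_unity_def by (blast, force)
  moreover have "(\<omega> - 1) * (\<omega> ^ 2 + \<omega> + 1) = \<omega> ^ 3 - 1" by algebra
  ultimately have w: "\<omega> ^ 2 + \<omega> + 1 = 0" by simp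
  have nw: "norm \<omega> = 1"
    using power_eq_1_iff [OF w3] by simp
  note q = assms(2)
  note base = base_term_sums [OF w nw q]
  have "base_term \<omega> q n * q ^ n = ?f n" for n
  proof -
    have "n * (n + 3) = n * (n + 1) + 2 * n" by (simp add: algebra_simps)
    hence "n * (n + 3) div 2 = n * (n + 1) div 2 + n" by simp
    thus ?thesis unfolding base_term_def by (simp add: power_add)
  qed
  thus "?f sums (J2 5 12 q / (J1 3 q * qpoch_inf (\<omega> * q ^ 2) (q ^ 4)))"
    using base(1) by simp
  show "?g sums (J2 1 12 q / (J1 3 q * qpoch_inf (\<omega> * q ^ 2) (q ^ 4)))"
  \<comment> \<open>The shift identity determines only \<open>q\<close> times the second series, so
    q = 0 is settled directly: the term of index 0 alone remains, and both sides are 1.\<close>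
  proof (cases "q = 0")
    case True
    have "?g sums ?g 0"
    proof (rule sums_first_term)
      fix n
      have "Suc n * (Suc n + 3) div 2 \<noteq> 0" by simp
      thus "?g (Suc n) = 0" using True by simp
    qed
    thus ?thesis using True by (simp add: J1_def J2_def qpoch_def)
  next
    case False
    define h where "h = (\<lambda>n. base_term \<omega> q n * (\<omega> ^ 2 + q ^ n + \<omega> * (q ^ n) ^ 2))"
    have "h 0 = base_term \<omega> q 0 * (\<omega> ^ 2 + \<omega> + 1)" by (simp add: h_def add_ac)
    hence "h 0 = 0" unfolding w by simp
    hence "(\<lambda>n. h (Suc n)) sums (q * J2 1 12 q / (J1 3 q * qpoch_inf (\<omega> * q ^ 2) (q ^ 4)))"
      using base(2) unfolding h_def [symmetric] by (subst sums_Suc_iff) simp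
    hence "(\<lambda>n. q * ?g n) sums (q * (J2 1 12 q / (J1 3 q * qpoch_inf (\<omega> * q ^ 2) (q ^ 4))))"
      unfolding h_def base_term_shift [OF w nw q] by simp
    thus ?thesis by (rule iffD1 [OF sums_mult_iff [OF False]])
  qed
qed

end
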